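(* Let $\phi:R\to S$ be a finite ring extension of $F$-finite noetherian rings of prime characteristic $p>0$. Let $X_\phi$ be the set of primes $\mathfrak{p}\in\operatorname{Spec}R$ for which $\phi_\mathfrak{p}=\phi\otimes_RR_\mathfrak{p}:R_\mathfrak{p}\to S\otimes_RR_\mathfrak{p}$ is a purely inseparable extension; for $\mathfrak{p}\in X_\phi$ let $\mathfrak{q}$ denote the unique prime of $S$ lying over $\mathfrak{p}$, so that $S\otimes_RR_\mathfrak{p}=S_\mathfrak{q}$. Then there is an $e_0\in\mathbf{N}$ such that for all $\mathfrak{p}\in X_\phi$ such that $S_\mathfrak{q}$ is $F$-pure, $\operatorname{Fte}I\le e_0$ for all ideals $I\subset R_\mathfrak{p}$. In particular, if the image in $\operatorname{Spec}R$ of the $F$-pure locus of $S$ is also open in $\operatorname{Spec}R$, then there is an open set in $\operatorname{Spec}R$ on which the Frobenius test exponent of all ideals (of the local rings $R_\mathfrak{p}$, for $\mathfrak{p}$ in the open set) has a uniform upper bound.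
   Context: All rings are commutative noetherian of prime characteristic $p>0$. A ring $R$ is $F$-finite if the Frobenius map $F:R\to R$, $r\mapsto r^p$, is a finite ring map. A ring is $F$-pure if its Frobenius map is a pure ring map; the $F$-pure locus of $S$ is the set of primes $\mathfrak{q}\in\operatorname{Spec}S$ with $S_\mathfrak{q}$ $F$-pure. A ring extension is an injective ring map. A ring extension $R\to S$ is purely inseparable if for each $s\in S$ one has $s^{p^e}\in R$ for some $e\in\mathbf{N}$. A purely inseparable extension induces a homeomorphism on spectra, so for $\mathfrak{p}\in X_\phi$ the ring $S\otimes_RR_\mathfrak{p}$ is local and equals $S_\mathfrak{q}$ for a unique prime $\mathfrak{q}$ of $S$ lying over $\mathfrak{p}$. For an ideal $I$ of a ring $A$, $I^{[p^e]}$ is the ideal generated by $\{a^{p^e}\mid a\in I\}$, and the Frobenius closure is $I^F:=\{x\in A\mid x^{p^e}\in I^{[p^e]}\text{ for some }e\gg0\}$. The Frobenius test exponent $\operatorname{Fte}I$ is the smallest $e$ such that $(I^F)^{[p^e]}=I^{[p^e]}$. *)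

theory Defs
  imports
    "HOL-Algebra.Algebra"
    "HOL-Analysis.Abstract_Topology"
    "HOL-Library.Extended_Nat"
begin

section \<open>Modules, finite ring maps, purity\<close>

definition restrict_scalars ::
    "('a \<Rightarrow> 'b) \<Rightarrow> ('b, 's) ring_scheme \<Rightarrow> ('a, 'b) module" where
  "restrict_scalars \<phi> S =
     \<lparr>carrier = carrier S, monoid.mult = monoid.mult S, monoid.one = monoid.one S,
      ring.zero = ring.zero S, ring.add = ring.add S,
      smult = (\<lambda>r s. \<phi> r \<otimes>\<^bsub>S\<^esub> s)\<rparr>"

definition finitely_generated_module ::
    "('a, 'r) ring_scheme \<Rightarrow> ('a, 'm, 'x) module_scheme \<Rightarrow> bool" where
  "finitely_generated_module R M \<longleftrightarrow>
     (\<exists>A. finite A \<and> A \<subseteq> carrier M \<and>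
        (\<forall>m\<in>carrier M. \<exists>c \<in> A \<rightarrow> carrier R. m = (\<Oplus>\<^bsub>M\<^esub>a\<in>A. c a \<odot>\<^bsub>M\<^esub> a)))"

definition finite_ring_map ::
    "('a, 'r) ring_scheme \<Rightarrow> ('b, 's) ring_scheme \<Rightarrow> ('a \<Rightarrow> 'b) \<Rightarrow> bool" where
  "finite_ring_map R S \<phi> \<longleftrightarrow>
     \<phi> \<in> ring_hom R S \<and> finitely_generated_module R (restrict_scalars \<phi> S)"

definition ring_extension ::
    "('a, 'r) ring_scheme \<Rightarrow> ('b, 's) ring_scheme \<Rightarrow> ('a \<Rightarrow> 'b) \<Rightarrow> bool" where
  "ring_extension R S \<phi> \<longleftrightarrow> \<phi> \<in> ring_hom R S \<and> inj_on \<phi> (carrier R)"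

definition tensor_relations ::
    "('a, 'r) ring_scheme \<Rightarrow> ('a, 'm, 'x) module_scheme \<Rightarrow> ('a, 'n, 'y) module_scheme
      \<Rightarrow> ('m \<times> 'n \<Rightarrow>\<^sub>0 int) set" where
  "tensor_relations R M N =
     {frag_of (m \<oplus>\<^bsub>M\<^esub> m', n) - frag_of (m, n) - frag_of (m', n) | m m' n.
        m \<in> carrier M \<and> m' \<in> carrier M \<and> n \<in> carrier N} \<union>
     {frag_of (m, n \<oplus>\<^bsub>N\<^esub> n') - frag_of (m, n) - frag_of (m, n') | m n n'.
        m \<in> carrier M \<and> n \<in> carrier N \<and> n' \<in> carrier N} \<union>
     {frag_of (r \<odot>\<^bsub>M\<^esub> m, n) - frag_of (m, r \<odot>\<^bsub>N\<^esub> n) | r m n.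
        r \<in> carrier R \<and> m \<in> carrier M \<and> n \<in> carrier N}"

text \<open>The underlying abelian group of the tensor product of M and N over R is the quotient of the
  free abelian group on pairs by the subgroup generated by the bilinearity relations; its elements
  are cosets of that subgroup, and \<open>pure_tensor R M N m n\<close> is the class of the pair (m, n).\<close>

definition tensor_subgroup ::
    "('a, 'r) ring_scheme \<Rightarrow> ('a, 'm, 'x) module_scheme \<Rightarrow> ('a, 'n, 'y) module_scheme
      \<Rightarrow> ('m \<times> 'n \<Rightarrow>\<^sub>0 int) set" where
  "tensor_subgroup R M N =
     generate (free_Abelian_group (carrier M \<times> carrier N)) (tensor_relations R M N)"

definition tensor_group ::
    "('a, 'r) ring_scheme \<Rightarrow> ('a, 'm, 'x) module_scheme \<Rightarrow> ('a, 'n, 'y) module_scheme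
      \<Rightarrow> ('m \<times> 'n \<Rightarrow>\<^sub>0 int) set monoid" where
  "tensor_group R M N =
     free_Abelian_group (carrier M \<times> carrier N) Mod tensor_subgroup R M N"

definition pure_tensor ::
    "('a, 'r) ring_scheme \<Rightarrow> ('a, 'm, 'x) module_scheme \<Rightarrow> ('a, 'n, 'y) module_scheme
      \<Rightarrow> 'm \<Rightarrow> 'n \<Rightarrow> ('m \<times> 'n \<Rightarrow>\<^sub>0 int) set" where
  "pure_tensor R M N m n =
     tensor_subgroup R M N #>\<^bsub>free_Abelian_group (carrier M \<times> carrier N)\<^esub> frag_of (m, n)"

lemma pure_tensor_closed:
  assumes "m \<in> carrier M" "n \<in> carrier N"
  shows "pure_tensor R M N m n \<in> carrier (tensor_group R M N)"
  using assms by (auto simp: pure_tensor_def tensor_group_def FactGroup_def RCOSETS_def)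

text \<open>A ring map from R to S is pure if M maps injectively to the tensor product of M and S over R
  for every R-module M.  A HOL quantifier ranges over a single type, so M has to live in a fixed
  universe, for which we take \<open>(nat \<Rightarrow> 'a) set\<close> where \<open>'a\<close> is the type of elements of R.
  This loses nothing: every finitely generated module is a quotient of some free module of finite
  rank, whose elements are encoded as sequences, so it has an isomorphic copy whose elements are
  sets of sequences; and an arbitrary module is the directed union of its finitely generated
  submodules, with which tensor products commute.\<close>

definition pure_ring_map ::
    "('a, 'r) ring_scheme \<Rightarrow> ('b, 's) ring_scheme \<Rightarrow> ('a \<Rightarrow> 'b) \<Rightarrow> bool" where
  "pure_ring_map R S \<phi> \<longleftrightarrow>
     \<phi> \<in> ring_hom R S \<and>
     (\<forall>M :: ('a, (nat \<Rightarrow> 'a) set) module. module R M \<longrightarrow>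
        inj_on (\<lambda>m. pure_tensor R M (restrict_scalars \<phi> S) m \<one>\<^bsub>S\<^esub>) (carrier M))"

section \<open>Prime characteristic\<close>

text \<open>\<open>group.ord\<close> is 0 on elements of infinite order, so this is the usual characteristic.\<close>

definition ring_char :: "('a, 'r) ring_scheme \<Rightarrow> nat" where
  "ring_char R = group.ord (add_monoid R) \<one>\<^bsub>R\<^esub>"

definition frobenius :: "nat \<Rightarrow> ('a, 'r) ring_scheme \<Rightarrow> 'a \<Rightarrow> 'a" where
  "frobenius p R = (\<lambda>r. r [^]\<^bsub>R\<^esub> p)"

definition F_finite :: "nat \<Rightarrow> ('a, 'r) ring_scheme \<Rightarrow> bool" where
  "F_finite p R \<longleftrightarrow> finite_ring_map R R (frobenius p R)"

definition F_pure :: "nat \<Rightarrow> ('a, 'r) ring_scheme \<Rightarrow> bool" where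
  "F_pure p R \<longleftrightarrow> pure_ring_map R R (frobenius p R)"

definition purely_inseparable ::
    "nat \<Rightarrow> ('a, 'r) ring_scheme \<Rightarrow> ('b, 's) ring_scheme \<Rightarrow> ('a \<Rightarrow> 'b) \<Rightarrow> bool" where
  "purely_inseparable p R S \<phi> \<longleftrightarrow>
     ring_extension R S \<phi> \<and>
     (\<forall>s\<in>carrier S. \<exists>e::nat. s [^]\<^bsub>S\<^esub> (p ^ e) \<in> \<phi> ` carrier R)"

definition frobenius_power :: "nat \<Rightarrow> ('a, 'r) ring_scheme \<Rightarrow> nat \<Rightarrow> 'a set \<Rightarrow> 'a set" where
  "frobenius_power p A e I = Idl\<^bsub>A\<^esub> ((\<lambda>a. a [^]\<^bsub>A\<^esub> (p ^ e)) ` I)"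

text \<open>If the membership below holds for e, then it holds for every larger exponent, so it makes no
  difference whether e is required to be large.\<close>

definition frobenius_closure :: "nat \<Rightarrow> ('a, 'r) ring_scheme \<Rightarrow> 'a set \<Rightarrow> 'a set" where
  "frobenius_closure p A I =
     {x \<in> carrier A. \<exists>e::nat. x [^]\<^bsub>A\<^esub> (p ^ e) \<in> frobenius_power p A e I}"

text \<open>The least exponent, or infinity if there is none.\<close>

definition Fte :: "nat \<Rightarrow> ('a, 'r) ring_scheme \<Rightarrow> 'a set \<Rightarrow> enat" where
  "Fte p A I =
     Inf (enat ` {e. frobenius_power p A e (frobenius_closure p A I) = frobenius_power p A e I})"

section \<open>Localization\<close>

text \<open>For a multiplicatively closed subset D, two pairs (a, s) and (b, t) represent the same fraction
  if u t a = u s b for some u in D.\<close>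

definition fraction_rel :: "('a, 'r) ring_scheme \<Rightarrow> 'a set \<Rightarrow> (('a \<times> 'a) \<times> ('a \<times> 'a)) set" where
  "fraction_rel A D =
     {((a, s), (b, t)). a \<in> carrier A \<and> s \<in> D \<and> b \<in> carrier A \<and> t \<in> D \<and>
        (\<exists>u\<in>D. u \<otimes>\<^bsub>A\<^esub> (t \<otimes>\<^bsub>A\<^esub> a) = u \<otimes>\<^bsub>A\<^esub> (s \<otimes>\<^bsub>A\<^esub> b))}"

definition fraction :: "('a, 'r) ring_scheme \<Rightarrow> 'a set \<Rightarrow> 'a \<Rightarrow> 'a \<Rightarrow> ('a \<times> 'a) set" where
  "fraction A D a s = fraction_rel A D `` {(a, s)}"

definition localization :: "('a, 'r) ring_scheme \<Rightarrow> 'a set \<Rightarrow> ('a \<times> 'a) set ring" where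
  "localization A D =
     \<lparr>carrier = (carrier A \<times> D) // fraction_rel A D,
      monoid.mult = (\<lambda>x y. \<Union>(a, s)\<in>x. \<Union>(b, t)\<in>y. fraction A D (a \<otimes>\<^bsub>A\<^esub> b) (s \<otimes>\<^bsub>A\<^esub> t)),
      monoid.one = fraction A D \<one>\<^bsub>A\<^esub> \<one>\<^bsub>A\<^esub>,
      ring.zero = fraction A D \<zero>\<^bsub>A\<^esub> \<one>\<^bsub>A\<^esub>,
      ring.add = (\<lambda>x y. \<Union>(a, s)\<in>x. \<Union>(b, t)\<in>y.
               fraction A D (t \<otimes>\<^bsub>A\<^esub> a \<oplus>\<^bsub>A\<^esub> s \<otimes>\<^bsub>A\<^esub> b) (s \<otimes>\<^bsub>A\<^esub> t))\<rparr>"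

locale mult_closed = cring A for A (structure) and D +
  assumes D_sub: "D \<subseteq> carrier A" and one_D: "\<one> \<in> D"
    and mult_D: "\<lbrakk>s \<in> D; t \<in> D\<rbrakk> \<Longrightarrow> s \<otimes> t \<in> D"
begin

lemma D_carrier [simp]: "s \<in> D \<Longrightarrow> s \<in> carrier A"
  using D_sub by blast

lemma fraction_rel_iff:
  "((a, s), (b, t)) \<in> fraction_rel A D \<longleftrightarrow> a \<in> carrier A \<and> s \<in> D \<and> b \<in> carrier A \<and> t \<in> D \<and>
     (\<exists>u\<in>D. u \<otimes> (t \<otimes> a) = u \<otimes> (s \<otimes> b))"
  by (simp add: fraction_rel_def)

lemma equiv_fraction_rel: "equiv (carrier A \<times> D) (fraction_rel A D)"
proof (rule equivI)
  show "fraction_rel A D \<subseteq> (carrier A \<times> D) \<times> (carrier A \<times> D)"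
    by (auto simp: fraction_rel_def)
  show "refl_on (carrier A \<times> D) (fraction_rel A D)"
    using one_D by (auto simp: refl_on_def fraction_rel_iff)
  show "sym (fraction_rel A D)"
  proof (rule symI, clarify)
    fix a s b t assume "((a, s), (b, t)) \<in> fraction_rel A D"
    then show "((b, t), (a, s)) \<in> fraction_rel A D"
      unfolding fraction_rel_iff by (metis (no_types))
  qed
  show "trans (fraction_rel A D)"
  proof (rule transI, clarify)
    fix a s b t c v
    assume 1: "((a, s), (b, t)) \<in> fraction_rel A D" and 2: "((b, t), (c, v)) \<in> fraction_rel A D"
    obtain u where u: "u \<in> D" "u \<otimes> (t \<otimes> a) = u \<otimes> (s \<otimes> b)"
      using 1 by (auto simp: fraction_rel_iff)
    obtain w where w: "w \<in> D" "w \<otimes> (v \<otimes> b) = w \<otimes> (t \<otimes> c)"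
      using 2 by (auto simp: fraction_rel_iff)
    have D: "a \<in> carrier A" "b \<in> carrier A" "c \<in> carrier A" "s \<in> D" "t \<in> D" "v \<in> D"
      using 1 2 by (auto simp: fraction_rel_iff)
    have "(u \<otimes> w \<otimes> t) \<otimes> (v \<otimes> a) = (w \<otimes> v) \<otimes> (u \<otimes> (t \<otimes> a))"
      using D u(1) w(1) by (simp add: m_ac)
    also have "\<dots> = (u \<otimes> s) \<otimes> (w \<otimes> (v \<otimes> b))"
      unfolding u(2) using D u(1) w(1) by (simp add: m_ac)
    also have "\<dots> = (u \<otimes> w \<otimes> t) \<otimes> (s \<otimes> c)"
      unfolding w(2) using D u(1) w(1) by (simp add: m_ac)
    finally show "((a, s), (c, v)) \<in> fraction_rel A D"
      using D u(1) w(1) mult_D by (auto simp: fraction_rel_iff)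
  qed
qed

lemma fraction_eq_iff:
  assumes "a \<in> carrier A" "b \<in> carrier A" "s \<in> D" "t \<in> D"
  shows "fraction A D a s = fraction A D b t \<longleftrightarrow> (\<exists>u\<in>D. u \<otimes> (t \<otimes> a) = u \<otimes> (s \<otimes> b))"
  unfolding fraction_def
  using assms by (subst eq_equiv_class_iff[OF equiv_fraction_rel]) (auto simp: fraction_rel_iff)

lemma fraction_eqI:
  assumes "a \<in> carrier A" "b \<in> carrier A" "s \<in> D" "t \<in> D" "t \<otimes> a = s \<otimes> b"
  shows "fraction A D a s = fraction A D b t"
  using assms one_D by (auto simp: fraction_eq_iff)

lemma fraction_carrier:
  "carrier (localization A D) = {fraction A D a s | a s. a \<in> carrier A \<and> s \<in> D}"
  by (auto simp: localization_def fraction_def quotient_def)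

lemma fraction_mem:
  "x \<in> fraction A D a s \<longleftrightarrow> ((a, s), x) \<in> fraction_rel A D"
  by (auto simp: fraction_def)

lemma fraction_self: "a \<in> carrier A \<Longrightarrow> s \<in> D \<Longrightarrow> (a, s) \<in> fraction A D a s"
  using one_D by (auto simp: fraction_mem fraction_rel_iff)

lemma localization_mult:
  assumes "a \<in> carrier A" "b \<in> carrier A" "s \<in> D" "t \<in> D"
  shows "fraction A D a s \<otimes>\<^bsub>localization A D\<^esub> fraction A D b t = fraction A D (a \<otimes> b) (s \<otimes> t)"
proof -
  have *: "fraction A D (c \<otimes> d) (v \<otimes> w) = fraction A D (a \<otimes> b) (s \<otimes> t)"
    if cv: "(c, v) \<in> fraction A D a s" and dw: "(d, w) \<in> fraction A D b t" for c v d w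
  proof -
    have D: "c \<in> carrier A" "d \<in> carrier A" "v \<in> D" "w \<in> D"
      using cv dw by (auto simp: fraction_mem fraction_rel_iff)
    obtain u u' where u: "u \<in> D" "u \<otimes> (v \<otimes> a) = u \<otimes> (s \<otimes> c)"
      and u': "u' \<in> D" "u' \<otimes> (w \<otimes> b) = u' \<otimes> (t \<otimes> d)"
      using cv dw by (auto simp: fraction_mem fraction_rel_iff)
    have "(u \<otimes> u') \<otimes> ((s \<otimes> t) \<otimes> (c \<otimes> d)) = (u \<otimes> (s \<otimes> c)) \<otimes> (u' \<otimes> (t \<otimes> d))"
      using assms D u(1) u'(1) by (simp add: m_ac)
    also have "\<dots> = (u \<otimes> (v \<otimes> a)) \<otimes> (u' \<otimes> (w \<otimes> b))"
      by (simp only: u(2) u'(2))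
    also have "\<dots> = (u \<otimes> u') \<otimes> ((v \<otimes> w) \<otimes> (a \<otimes> b))"
      using assms D u(1) u'(1) by (simp add: m_ac)
    finally show ?thesis
      using assms D u(1) u'(1) mult_D by (subst fraction_eq_iff) auto
  qed
  have "(\<Union>(c, v)\<in>fraction A D a s. \<Union>(d, w)\<in>fraction A D b t. fraction A D (c \<otimes> d) (v \<otimes> w)) =
      (\<Union>_\<in>fraction A D a s. \<Union>_\<in>fraction A D b t. fraction A D (a \<otimes> b) (s \<otimes> t))"
    by (intro SUP_cong refl) (auto simp only: * split: prod.splits)
  also have "\<dots> = fraction A D (a \<otimes> b) (s \<otimes> t)"
    using fraction_self[OF assms(1,3)] fraction_self[OF assms(2,4)] by auto
  finally show ?thesis by (simp add: localization_def)
qed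

lemma localization_add:
  assumes "a \<in> carrier A" "b \<in> carrier A" "s \<in> D" "t \<in> D"
  shows "fraction A D a s \<oplus>\<^bsub>localization A D\<^esub> fraction A D b t =
           fraction A D (t \<otimes> a \<oplus> s \<otimes> b) (s \<otimes> t)"
proof -
  have *: "fraction A D (w \<otimes> c \<oplus> v \<otimes> d) (v \<otimes> w) = fraction A D (t \<otimes> a \<oplus> s \<otimes> b) (s \<otimes> t)"
    if cv: "(c, v) \<in> fraction A D a s" and dw: "(d, w) \<in> fraction A D b t" for c v d w
  proof -
    have D: "c \<in> carrier A" "d \<in> carrier A" "v \<in> D" "w \<in> D"
      using cv dw by (auto simp: fraction_mem fraction_rel_iff)
    obtain u u' where u: "u \<in> D" "u \<otimes> (v \<otimes> a) = u \<otimes> (s \<otimes> c)"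
      and u': "u' \<in> D" "u' \<otimes> (w \<otimes> b) = u' \<otimes> (t \<otimes> d)"
      using cv dw by (auto simp: fraction_mem fraction_rel_iff)
    have "(u \<otimes> u') \<otimes> ((s \<otimes> t) \<otimes> (w \<otimes> c \<oplus> v \<otimes> d))
        = (u' \<otimes> t \<otimes> w) \<otimes> (u \<otimes> (s \<otimes> c)) \<oplus> (u \<otimes> s \<otimes> v) \<otimes> (u' \<otimes> (t \<otimes> d))"
      using assms D u(1) u'(1) by (simp add: r_distr m_ac)
    also have "\<dots> = (u' \<otimes> t \<otimes> w) \<otimes> (u \<otimes> (v \<otimes> a)) \<oplus> (u \<otimes> s \<otimes> v) \<otimes> (u' \<otimes> (w \<otimes> b))"
      by (simp only: u(2) u'(2))
    also have "\<dots> = (u \<otimes> u') \<otimes> ((v \<otimes> w) \<otimes> (t \<otimes> a \<oplus> s \<otimes> b))"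
      using assms D u(1) u'(1) by (simp add: r_distr m_ac)
    finally show ?thesis
      using assms D u(1) u'(1) mult_D by (subst fraction_eq_iff) auto
  qed
  have "(\<Union>(c, v)\<in>fraction A D a s. \<Union>(d, w)\<in>fraction A D b t. fraction A D (w \<otimes> c \<oplus> v \<otimes> d) (v \<otimes> w)) =
      (\<Union>_\<in>fraction A D a s. \<Union>_\<in>fraction A D b t. fraction A D (t \<otimes> a \<oplus> s \<otimes> b) (s \<otimes> t))"
    by (intro SUP_cong refl) (auto simp only: * split: prod.splits)
  also have "\<dots> = fraction A D (t \<otimes> a \<oplus> s \<otimes> b) (s \<otimes> t)"
    using fraction_self[OF assms(1,3)] fraction_self[OF assms(2,4)] by auto
  finally show ?thesis by (simp add: localization_def)
qed

lemma localization_one: "\<one>\<^bsub>localization A D\<^esub> = fraction A D \<one> \<one>"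
  and localization_zero: "\<zero>\<^bsub>localization A D\<^esub> = fraction A D \<zero> \<one>"
  by (simp_all add: localization_def)

lemma fraction_closed:
  "a \<in> carrier A \<Longrightarrow> s \<in> D \<Longrightarrow> fraction A D a s \<in> carrier (localization A D)"
  by (auto simp: fraction_carrier)

lemma localization_cring: "cring (localization A D)"
proof (rule cringI)
  let ?L = "localization A D"
  have cases: thesis if "x \<in> carrier ?L"
    "\<And>a s. a \<in> carrier A \<Longrightarrow> s \<in> D \<Longrightarrow> x = fraction A D a s \<Longrightarrow> thesis" for x thesis
    using that by (auto simp: fraction_carrier)
  note [simp] = localization_mult localization_add localization_one localization_zero one_D mult_D
    fraction_closed
  show "abelian_group ?L"
  proof (rule abelian_groupI)
    fix x y z assume "x \<in> carrier ?L" "y \<in> carrier ?L" "z \<in> carrier ?L"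
    then obtain a s b t c v where *: "a \<in> carrier A" "s \<in> D" "x = fraction A D a s"
      "b \<in> carrier A" "t \<in> D" "y = fraction A D b t" "c \<in> carrier A" "v \<in> D" "z = fraction A D c v"
      by (elim cases)
    show "x \<oplus>\<^bsub>?L\<^esub> y \<oplus>\<^bsub>?L\<^esub> z = x \<oplus>\<^bsub>?L\<^esub> (y \<oplus>\<^bsub>?L\<^esub> z)"
      using * by (simp, intro fraction_eqI) (simp_all add: r_distr m_ac a_ac)
  next
    fix x y assume "x \<in> carrier ?L" "y \<in> carrier ?L"
    then obtain a s b t where *: "a \<in> carrier A" "s \<in> D" "x = fraction A D a s"
      "b \<in> carrier A" "t \<in> D" "y = fraction A D b t"
      by (elim cases)
    show "x \<oplus>\<^bsub>?L\<^esub> y \<in> carrier ?L" using * by simp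
    show "x \<oplus>\<^bsub>?L\<^esub> y = y \<oplus>\<^bsub>?L\<^esub> x" using * by (simp add: m_comm a_comm)
  next
    show "\<zero>\<^bsub>?L\<^esub> \<in> carrier ?L" by simp
  next
    fix x assume "x \<in> carrier ?L"
    then obtain a s where *: "a \<in> carrier A" "s \<in> D" "x = fraction A D a s"
      by (elim cases)
    show "\<zero>\<^bsub>?L\<^esub> \<oplus>\<^bsub>?L\<^esub> x = x" using * by simp
    have "fraction A D (\<ominus> a) s \<oplus>\<^bsub>?L\<^esub> x = \<zero>\<^bsub>?L\<^esub>"
      using * by (simp, intro fraction_eqI) (simp_all add: r_minus l_neg)
    then show "\<exists>y\<in>carrier ?L. y \<oplus>\<^bsub>?L\<^esub> x = \<zero>\<^bsub>?L\<^esub>" using * by fastforce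
  qed
  show "Group.comm_monoid ?L"
  proof (rule Group.comm_monoidI)
    fix x y z assume "x \<in> carrier ?L" "y \<in> carrier ?L" "z \<in> carrier ?L"
    then obtain a s b t c v where *: "a \<in> carrier A" "s \<in> D" "x = fraction A D a s"
      "b \<in> carrier A" "t \<in> D" "y = fraction A D b t" "c \<in> carrier A" "v \<in> D" "z = fraction A D c v"
      by (elim cases)
    show "x \<otimes>\<^bsub>?L\<^esub> y \<otimes>\<^bsub>?L\<^esub> z = x \<otimes>\<^bsub>?L\<^esub> (y \<otimes>\<^bsub>?L\<^esub> z)" using * by (simp add: m_ac)
  next
    fix x y assume "x \<in> carrier ?L" "y \<in> carrier ?L"
    then obtain a s b t where *: "a \<in> carrier A" "s \<in> D" "x = fraction A D a s"
      "b \<in> carrier A" "t \<in> D" "y = fraction A D b t"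
      by (elim cases)
    show "x \<otimes>\<^bsub>?L\<^esub> y \<in> carrier ?L" using * by simp
    show "x \<otimes>\<^bsub>?L\<^esub> y = y \<otimes>\<^bsub>?L\<^esub> x" using * by (simp add: m_comm)
  next
    show "\<one>\<^bsub>?L\<^esub> \<in> carrier ?L" by simp
  next
    fix x assume "x \<in> carrier ?L"
    then obtain a s where *: "a \<in> carrier A" "s \<in> D" "x = fraction A D a s"
      by (elim cases)
    show "\<one>\<^bsub>?L\<^esub> \<otimes>\<^bsub>?L\<^esub> x = x" using * by simp
  qed
  fix x y z assume "x \<in> carrier ?L" "y \<in> carrier ?L" "z \<in> carrier ?L"
  then obtain a s b t c v where *: "a \<in> carrier A" "s \<in> D" "x = fraction A D a s"
    "b \<in> carrier A" "t \<in> D" "y = fraction A D b t" "c \<in> carrier A" "v \<in> D" "z = fraction A D c v"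
    by (elim cases)
  show "(x \<oplus>\<^bsub>?L\<^esub> y) \<otimes>\<^bsub>?L\<^esub> z = x \<otimes>\<^bsub>?L\<^esub> z \<oplus>\<^bsub>?L\<^esub> y \<otimes>\<^bsub>?L\<^esub> z"
    using * by (simp, intro fraction_eqI) (simp_all add: l_distr r_distr m_ac)
qed

end

lemma (in primeideal) mult_closed_complement: "mult_closed R (carrier R - I)"
proof (unfold_locales, goal_cases)
  case 2
  then show ?case using I_notcarr one_imp_carrier by auto
next
  case (3 s t)
  then show ?case using I_prime by blast
qed auto

definition localization_at :: "('a, 'r) ring_scheme \<Rightarrow> 'a set \<Rightarrow> ('a \<times> 'a) set ring" where
  "localization_at A P = localization A (carrier A - P)"

text \<open>For a prime P of R, the tensor product of S and the localization of R at P over R is the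
  localization of S at the image of the complement of P.\<close>

definition base_change_at ::
    "('a, 'r) ring_scheme \<Rightarrow> ('b, 's) ring_scheme \<Rightarrow> ('a \<Rightarrow> 'b) \<Rightarrow> 'a set
      \<Rightarrow> ('b \<times> 'b) set ring" where
  "base_change_at R S \<phi> P = localization S (\<phi> ` (carrier R - P))"

definition localized_map ::
    "('a, 'r) ring_scheme \<Rightarrow> ('b, 's) ring_scheme \<Rightarrow> ('a \<Rightarrow> 'b) \<Rightarrow> 'a set
      \<Rightarrow> ('a \<times> 'a) set \<Rightarrow> ('b \<times> 'b) set" where
  "localized_map R S \<phi> P x = (\<Union>(a, s)\<in>x. fraction S (\<phi> ` (carrier R - P)) (\<phi> a) (\<phi> s))"

section \<open>Spectra\<close>

definition Spec :: "('a, 'r) ring_scheme \<Rightarrow> 'a set set" where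
  "Spec R = {P. primeideal P R}"

definition zariski_topology :: "('a, 'r) ring_scheme \<Rightarrow> 'a set topology" where
  "zariski_topology R =
     topology (\<lambda>U. \<exists>E\<subseteq>carrier R. U = {P \<in> Spec R. \<not> E \<subseteq> P})"

lemma openin_zariski_topology:
  assumes "cring R"
  shows "openin (zariski_topology R) U \<longleftrightarrow> (\<exists>E\<subseteq>carrier R. U = {P \<in> Spec R. \<not> E \<subseteq> P})"
proof -
  interpret cring R by fact
  let ?D = "\<lambda>E. {P \<in> Spec R. \<not> E \<subseteq> P}"
  have "istopology (\<lambda>U. \<exists>E\<subseteq>carrier R. U = ?D E)"
    unfolding istopology_def
  proof (intro conjI allI impI)
    fix U V
    assume "\<exists>E\<subseteq>carrier R. U = ?D E" "\<exists>F\<subseteq>carrier R. V = ?D F"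
    then obtain E F where EF: "E \<subseteq> carrier R" "F \<subseteq> carrier R" "U = ?D E" "V = ?D F"
      by blast
    let ?G = "{e \<otimes>\<^bsub>R\<^esub> f | e f. e \<in> E \<and> f \<in> F}"
    have "(\<not> E \<subseteq> P \<and> \<not> F \<subseteq> P) \<longleftrightarrow> \<not> ?G \<subseteq> P" if "P \<in> Spec R" for P
    proof -
      interpret P: primeideal P R using that by (simp add: Spec_def)
      show ?thesis
      proof
        assume "\<not> E \<subseteq> P \<and> \<not> F \<subseteq> P"
        then obtain e f where "e \<in> E" "f \<in> F" "e \<notin> P" "f \<notin> P" by blast
        then show "\<not> ?G \<subseteq> P" using P.I_prime EF(1,2) by blast
      next
        assume "\<not> ?G \<subseteq> P"
        then obtain e f where "e \<in> E" "f \<in> F" "e \<otimes>\<^bsub>R\<^esub> f \<notin> P" by blast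
        then show "\<not> E \<subseteq> P \<and> \<not> F \<subseteq> P"
          using EF(1,2) P.I_l_closed P.I_r_closed by blast
      qed
    qed
    then have "U \<inter> V = ?D ?G" unfolding EF(3,4) by blast
    moreover have "?G \<subseteq> carrier R" using EF(1,2) by auto
    ultimately show "\<exists>E\<subseteq>carrier R. U \<inter> V = ?D E" by blast
  next
    fix \<K>
    assume "\<forall>K\<in>\<K>. \<exists>E\<subseteq>carrier R. K = ?D E"
    then obtain E where E: "\<And>K. K \<in> \<K> \<Longrightarrow> E K \<subseteq> carrier R \<and> K = ?D (E K)" by metis
    then have "\<Union>\<K> = ?D (\<Union>K\<in>\<K>. E K)" by blast
    moreover have "(\<Union>K\<in>\<K>. E K) \<subseteq> carrier R" using E by blast
    ultimately show "\<exists>E\<subseteq>carrier R. \<Union>\<K> = ?D E" by blast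
  qed
  then show ?thesis unfolding zariski_topology_def by (simp add: topology_inverse')
qed

definition contraction ::
    "('a, 'r) ring_scheme \<Rightarrow> ('a \<Rightarrow> 'b) \<Rightarrow> 'b set \<Rightarrow> 'a set" where
  "contraction R \<phi> Q = {r \<in> carrier R. \<phi> r \<in> Q}"

definition F_pure_locus :: "nat \<Rightarrow> ('a, 'r) ring_scheme \<Rightarrow> 'a set set" where
  "F_pure_locus p S = {Q \<in> Spec S. F_pure p (localization_at S Q)}"

text \<open>The set of primes of R at which the localized map is a purely inseparable extension.\<close>

definition purely_inseparable_locus ::
    "nat \<Rightarrow> ('a, 'r) ring_scheme \<Rightarrow> ('b, 's) ring_scheme \<Rightarrow> ('a \<Rightarrow> 'b) \<Rightarrow> 'a set set" where
  "purely_inseparable_locus p R S \<phi> =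
     {P \<in> Spec R. purely_inseparable p (localization_at R P) (base_change_at R S \<phi> P)
                     (localized_map R S \<phi> P)}"

end

(* Let J e be the ideal of all u in R with (u s)^(p^e) in R for every s in S.  These ideals
   increase with e, so they stabilize at some J e0, and since S is generated by finitely many
   elements, the purely inseparable locus is the complement of the closed set defined by J e0.
   At a prime P of this locus one has y^q in R_P for all y in S_Q, where q = p^e0.  If S_Q is F-pure,
   then all its ideals are Frobenius closed.  For an ideal I of R_P this applies to the ideal K of
   all y in S_Q with y^q in I^[q]: it contains I, hence the Frobenius closure of I. *)

theory Submission
  imports Defs
begin

text \<open>Pure inseparability at a prime provides exponents that depend on the element and on the
  prime. Finiteness of S over R removes the first dependence, the ascending chain condition in R the
  second. An element u of J e outside P carries the bound: the q-th power of a fraction s / t equals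
  (u s)^q / (u t)^q, and here numerator and denominator both come from R.

  F-purity is defined by tensor products with arbitrary modules. It is used for the modules A / I
  only, and only through its consequence that x^p in I^[p] forces x in I.

  Membership in K speaks about images in S_Q; injectivity of R_P -> S_Q turns it into a statement
  about R_P. Two localizations of S occur, S tensored with R_P in the definition of the locus and
  S_Q in the bound, so the facts about denominators are proved for a variable set E.\<close>

section \<open>Additivity of Frobenius, and Frobenius powers of ideals\<close>

lemma (in cring) ideal_of_closed:
  assumes "I \<subseteq> carrier R" "\<zero> \<in> I"
    and add: "\<And>a b. a \<in> I \<Longrightarrow> b \<in> I \<Longrightarrow> a \<oplus> b \<in> I"
    and mult: "\<And>x a. x \<in> carrier R \<Longrightarrow> a \<in> I \<Longrightarrow> x \<otimes> a \<in> I"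
  shows "ideal I R"
proof (rule idealI[OF ring_axioms])
  have "\<ominus> a \<in> I" if "a \<in> I" for a
    using mult[of "\<ominus> \<one>" a] that assms(1) by (auto simp: l_minus)
  then show "subgroup I (add_monoid R)"
    using assms by (auto intro!: add.subgroupI simp: a_inv_def[symmetric])
  show "x \<otimes> a \<in> I" "a \<otimes> x \<in> I" if "a \<in> I" "x \<in> carrier R" for a x
    using mult[OF that(2,1)] m_comm[of a x] that assms(1) by (blast, metis subsetD)
qed

text \<open>Additivity is taken from the assumption that Frobenius is a ring map, which is part of
  both \<open>F_finite\<close> and \<open>F_pure\<close>; the induction only iterates it.\<close>

lemma (in cring) frobenius_power_add:
  assumes "frobenius p R \<in> ring_hom R R" "x \<in> carrier R" "y \<in> carrier R"
  shows "(x \<oplus> y) [^] (p ^ e) = x [^] (p ^ e) \<oplus> y [^] (p ^ e)"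
proof (induction e)
  case 0
  then show ?case using assms by simp
next
  case (Suc e)
  have "(x \<oplus> y) [^] (p ^ Suc e) = ((x \<oplus> y) [^] (p ^ e)) [^] p"
    using assms by (simp add: nat_pow_pow mult.commute)
  also have "\<dots> = (x [^] (p ^ e)) [^] p \<oplus> (y [^] (p ^ e)) [^] p"
    using ring_hom_add[OF assms(1)] assms(2,3) by (simp add: Suc frobenius_def)
  finally show ?case
    using assms by (simp add: nat_pow_pow mult.commute)
qed

lemma (in cring) frobenius_power_zero:
  assumes "frobenius p R \<in> ring_hom R R"
  shows "\<zero> [^] (p ^ e) = \<zero>"
proof (induction e)
  case (Suc e)
  interpret F: ring_hom_ring R R "frobenius p R"
    using assms by (intro ring_hom_ringI2 ring_axioms)
  have "\<zero> [^] (p ^ Suc e) = (\<zero> [^] (p ^ e)) [^] p"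
    by (simp add: nat_pow_pow mult.commute)
  then show ?case using F.hom_zero Suc by (simp add: frobenius_def)
qed simp

lemma (in cring) frobenius_power_ideal:
  assumes "ideal I R"
  shows "ideal (frobenius_power p R e I) R"
  unfolding frobenius_power_def
  using ideal.Icarr[OF assms] by (intro genideal_ideal) auto

lemma (in cring) frobenius_power_self:
  assumes "ideal I R" "a \<in> I"
  shows "a [^] (p ^ e) \<in> frobenius_power p R e I"
  unfolding frobenius_power_def
  using ideal.Icarr[OF assms(1)] assms(2) genideal_self[of "(\<lambda>a. a [^] (p ^ e)) ` I"] by auto

section \<open>F-purity makes every ideal Frobenius closed\<close>

text \<open>Purity speaks of modules whose elements have type
  \<open>(nat \<Rightarrow> 'a) set\<close>, so the quotient by I has to be copied into that type.
  Only the projection \<open>\<pi>\<close> and its rules are exported, which hides the encoding from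
  then on.\<close>

lemma (in ideal) quotient_module:
  assumes "cring R"
  obtains M :: "('a, (nat \<Rightarrow> 'a) set) module" and \<pi> where "module R M"
    and "\<pi> \<in> carrier R \<rightarrow> carrier M"
    and "\<pi> \<zero> = \<zero>\<^bsub>M\<^esub>"
    and "\<And>x y. x \<in> carrier R \<Longrightarrow> y \<in> carrier R \<Longrightarrow> \<pi> x \<oplus>\<^bsub>M\<^esub> \<pi> y = \<pi> (x \<oplus> y)"
    and "\<And>r x. r \<in> carrier R \<Longrightarrow> x \<in> carrier R \<Longrightarrow> r \<odot>\<^bsub>M\<^esub> \<pi> x = \<pi> (r \<otimes> x)"
    and "\<And>x. x \<in> carrier R \<Longrightarrow> \<pi> x = \<zero>\<^bsub>M\<^esub> \<longleftrightarrow> x \<in> I"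
proof -
  interpret cring R by fact
  \<comment> \<open>A coset becomes the set of all sequences whose value at 0 lies in it; constant
    sequences show that it can be recovered.\<close>
  define enc :: "'a set \<Rightarrow> (nat \<Rightarrow> 'a) set" where "enc = (\<lambda>C. {f. f 0 \<in> C})"
  define dec :: "(nat \<Rightarrow> 'a) set \<Rightarrow> 'a set" where "dec = (\<lambda>Y. (\<lambda>f. f 0) ` Y)"
  have dec_enc [simp]: "dec (enc C) = C" for C
  proof -
    have "x \<in> dec (enc C)" if "x \<in> C" for x
      using that unfolding dec_def enc_def by (intro image_eqI[of _ _ "\<lambda>_. x"]) auto
    then show ?thesis by (auto simp: dec_def enc_def)
  qed
  define \<pi> where "\<pi> x = enc (I +> x)" for x
  \<comment> \<open>The fields \<open>mult\<close> and \<open>one\<close> are inherited from the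
    record of rings; the module axioms constrain only addition and scalar multiplication.\<close>
  define M :: "('a, (nat \<Rightarrow> 'a) set) module" where
    "M = \<lparr>carrier = \<pi> ` carrier R, monoid.mult = undefined, monoid.one = undefined,
      ring.zero = \<pi> \<zero>, ring.add = (\<lambda>u v. enc (dec u <+> dec v)),
      smult = (\<lambda>r u. enc ([mod I:] (I +> r) \<Otimes> dec u))\<rparr>"
  have add: "\<pi> x \<oplus>\<^bsub>M\<^esub> \<pi> y = \<pi> (x \<oplus> y)" if "x \<in> carrier R" "y \<in> carrier R" for x y
    using that by (simp add: M_def \<pi>_def a_rcos_sum)
  have smult: "r \<odot>\<^bsub>M\<^esub> \<pi> x = \<pi> (r \<otimes> x)" if "r \<in> carrier R" "x \<in> carrier R" for r x
    using that by (simp add: M_def \<pi>_def rcoset_mult_add)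
  have carrier_M: "carrier M = \<pi> ` carrier R" and zero_M: "\<zero>\<^bsub>M\<^esub> = \<pi> \<zero>"
    by (simp_all add: M_def)
  have "abelian_group M"
  proof (rule abelian_groupI)
    fix u assume "u \<in> carrier M"
    then obtain x where x: "x \<in> carrier R" "u = \<pi> x" by (auto simp: carrier_M)
    then show "\<exists>v\<in>carrier M. v \<oplus>\<^bsub>M\<^esub> u = \<zero>\<^bsub>M\<^esub>"
      by (intro bexI[of _ "\<pi> (\<ominus> x)"]) (auto simp: carrier_M zero_M add l_neg)
  qed (auto simp: carrier_M zero_M add a_ac)
  then have "module R M"
    using is_cring
    by (intro moduleI) (auto simp: carrier_M add smult l_distr r_distr m_assoc)
  moreover have "\<pi> x = \<zero>\<^bsub>M\<^esub> \<longleftrightarrow> x \<in> I" if "x \<in> carrier R" for x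
  proof -
    have "\<pi> x = \<zero>\<^bsub>M\<^esub> \<longleftrightarrow> I +> x = I +> \<zero>"
      unfolding zero_M \<pi>_def by (metis dec_enc)
    moreover have "I +> \<zero> = I" using a_subset by simp
    ultimately show ?thesis
      using a_rcos_const[of x] rcos_const_imp_mem[OF that] by argo
  qed
  ultimately show thesis
    using that[of M \<pi>] add smult by (simp add: carrier_M zero_M)
qed

text \<open>In the tensor product of R/I with R along the Frobenius map, the class of x tensored with 1
  equals the class of 1 tensored with the p-th power of x.  The elements y for which the class of
  1 tensored with y vanishes form an ideal containing the p-th powers of the elements of I.\<close>

lemma (in cring) F_pure_imp_Frobenius_closed_step:
  assumes "F_pure p R" "ideal I R" "x \<in> carrier R"
    and "x [^] p \<in> Idl ((\<lambda>a. a [^] p) ` I)"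
  shows "x \<in> I"
proof -
  interpret I: ideal I R by fact
  obtain M :: "('a, (nat \<Rightarrow> 'a) set) module" and \<pi> where M: "module R M"
    and \<pi>_closed: "\<pi> \<in> carrier R \<rightarrow> carrier M"
    and \<pi>_zero: "\<pi> \<zero> = \<zero>\<^bsub>M\<^esub>"
    and \<pi>_smult: "\<And>r x. r \<in> carrier R \<Longrightarrow> x \<in> carrier R \<Longrightarrow> r \<odot>\<^bsub>M\<^esub> \<pi> x = \<pi> (r \<otimes> x)"
    and \<pi>_ker: "\<And>x. x \<in> carrier R \<Longrightarrow> \<pi> x = \<zero>\<^bsub>M\<^esub> \<longleftrightarrow> x \<in> I"
    using I.quotient_module[OF is_cring] by metis
  interpret M: module R M by fact
  define N where "N = restrict_scalars (frobenius p R) R"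
  define G where "G = free_Abelian_group (carrier M \<times> carrier N)"
  \<comment> \<open>Vanishing of a tensor is expressed as membership in T of a representative in the
    free group, so that the computations are sums and differences of generators.\<close>
  define T where "T = tensor_subgroup R M N"
  interpret G: group G by (simp add: G_def)
  have N_simps: "carrier N = carrier R" "n \<oplus>\<^bsub>N\<^esub> n' = n \<oplus> n'" "r \<odot>\<^bsub>N\<^esub> n = r [^] p \<otimes> n" for n n' r
    by (simp_all add: N_def restrict_scalars_def frobenius_def)
  have frag: "frag_of (m, n) \<in> carrier G" if "m \<in> carrier M" "n \<in> carrier R" for m n
    using that by (simp add: G_def N_simps)
  have G_simps: "a \<otimes>\<^bsub>G\<^esub> b = a + b" for a b by (simp add: G_def)
  have diff_G: "a - b \<in> carrier G" if "a \<in> carrier G" "b \<in> carrier G" for a b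
    using that keys_diff[of a b] by (auto simp: G_def)
  have "tensor_relations R M N \<subseteq> carrier G"
    unfolding tensor_relations_def by (auto simp: N_simps intro!: diff_G frag)
  then have T: "subgroup T G"
    unfolding T_def tensor_subgroup_def G_def[symmetric] by (rule G.generate_is_subgroup)
  have T_add: "a + b \<in> T" if "a \<in> T" "b \<in> T" for a b
    using subgroup.m_closed[OF T that] by (simp add: G_simps)
  have T_uminus: "- a \<in> T" if "a \<in> T" for a
  proof -
    have "Poly_Mapping.keys a \<subseteq> carrier M \<times> carrier N"
      using subgroup.mem_carrier[OF T that] by (simp add: G_def)
    then show ?thesis using subgroup.m_inv_closed[OF T that] by (simp add: G_def)
  qed
  have T_diff: "a - b \<in> T" if "a \<in> T" "b \<in> T" for a b
    using T_add[OF that(1) T_uminus[OF that(2)]] by simp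
  have rel: "a \<in> T" if "a \<in> tensor_relations R M N" for a
    using that unfolding T_def tensor_subgroup_def by (rule generate.incl)
  have T_l_distr: "frag_of (m \<oplus>\<^bsub>M\<^esub> m', n) - frag_of (m, n) - frag_of (m', n) \<in> T"
    if "m \<in> carrier M" "m' \<in> carrier M" "n \<in> carrier R" for m m' n
    using that by (intro rel) (auto simp: tensor_relations_def N_simps)
  have T_r_distr: "frag_of (m, n \<oplus> n') - frag_of (m, n) - frag_of (m, n') \<in> T"
    if "m \<in> carrier M" "n \<in> carrier R" "n' \<in> carrier R" for m n n'
  proof (rule rel)
    have "\<exists>m1 n1 n1'. frag_of (m, n \<oplus> n') - frag_of (m, n) - frag_of (m, n') =
        frag_of (m1, n1 \<oplus>\<^bsub>N\<^esub> n1') - frag_of (m1, n1) - frag_of (m1, n1') \<and>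
        m1 \<in> carrier M \<and> n1 \<in> carrier N \<and> n1' \<in> carrier N"
      using that by (intro exI[of _ m] exI[of _ n] exI[of _ n']) (simp add: N_simps)
    then show "frag_of (m, n \<oplus> n') - frag_of (m, n) - frag_of (m, n') \<in> tensor_relations R M N"
      unfolding tensor_relations_def by (intro UnI1 UnI2 CollectI)
  qed
  have T_smult: "frag_of (r \<odot>\<^bsub>M\<^esub> m, n) - frag_of (m, r [^] p \<otimes> n) \<in> T"
    if "r \<in> carrier R" "m \<in> carrier M" "n \<in> carrier R" for r m n
  proof (rule rel)
    have "\<exists>r1 m1 n1. frag_of (r \<odot>\<^bsub>M\<^esub> m, n) - frag_of (m, r [^] p \<otimes> n) =
        frag_of (r1 \<odot>\<^bsub>M\<^esub> m1, n1) - frag_of (m1, r1 \<odot>\<^bsub>N\<^esub> n1) \<and>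
        r1 \<in> carrier R \<and> m1 \<in> carrier M \<and> n1 \<in> carrier N"
      using that by (intro exI[of _ r] exI[of _ m] exI[of _ n]) (simp add: N_simps)
    then show "frag_of (r \<odot>\<^bsub>M\<^esub> m, n) - frag_of (m, r [^] p \<otimes> n) \<in> tensor_relations R M N"
      unfolding tensor_relations_def by (intro UnI2 CollectI)
  qed
  \<comment> \<open>The additivity relation for 0 + 0 = 0 is minus this generator.\<close>
  have T_zero: "frag_of (\<zero>\<^bsub>M\<^esub>, n) \<in> T" if "n \<in> carrier R" for n
    using T_uminus[OF T_l_distr[of "\<zero>\<^bsub>M\<^esub>" "\<zero>\<^bsub>M\<^esub>" n]] that by simp
  define K where "K = {y \<in> carrier R. frag_of (\<pi> \<one>, y) \<in> T}"
  have \<pi>1: "\<pi> \<one> \<in> carrier M" using \<pi>_closed by auto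
  \<comment> \<open>Moving the scalar x across the tensor sign turns it into its p-th power:
    \<open>\<pi> x\<close> = x \<open>\<pi> \<one>\<close>, and the second factor is R with the
    action through Frobenius.\<close>
  have pow_K: "x [^] p \<otimes> y \<in> K \<longleftrightarrow> frag_of (\<pi> x, y) \<in> T"
    if "x \<in> carrier R" "y \<in> carrier R" for x y
  proof -
    have "frag_of (\<pi> x, y) - frag_of (\<pi> \<one>, x [^] p \<otimes> y) \<in> T"
      using T_smult[of x "\<pi> \<one>" y] \<pi>1 that by (simp add: \<pi>_smult)
    then show ?thesis
      using that T_diff[of "frag_of (\<pi> x, y)" "frag_of (\<pi> x, y) - frag_of (\<pi> \<one>, x [^] p \<otimes> y)"]
        T_add[of "frag_of (\<pi> \<one>, x [^] p \<otimes> y)" "frag_of (\<pi> x, y) - frag_of (\<pi> \<one>, x [^] p \<otimes> y)"]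
      by (auto simp: K_def)
  qed
  \<comment> \<open>The largest ideal inside K. Absorption holds by construction, so the bilinearity
    relations suffice and no action of R on the second tensor factor has to be built. It contains
    a^p for a in I because \<open>\<pi> a\<close> = 0 kills \<open>\<pi> a\<close> tensored with
    every y.\<close>
  define K' where "K' = {z \<in> carrier R. \<forall>y\<in>carrier R. z \<otimes> y \<in> K}"
  have zero_K: "\<zero> \<in> K"
    using T_uminus[OF T_r_distr[of "\<pi> \<one>" \<zero> \<zero>]] \<pi>1 by (simp add: K_def)
  have add_K: "y \<oplus> z \<in> K" if "y \<in> K" "z \<in> K" for y z
    using that T_add[OF T_add[OF T_r_distr[of "\<pi> \<one>" y z]], of "frag_of (\<pi> \<one>, y)" "frag_of (\<pi> \<one>, z)"] \<pi>1
    by (simp add: K_def)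
  have "ideal K' R"
  proof (rule ideal_of_closed)
    show "x \<otimes> a \<in> K'" if "x \<in> carrier R" "a \<in> K'" for x a
    proof -
      have "x \<otimes> a \<otimes> y = a \<otimes> (x \<otimes> y)" if "y \<in> carrier R" for y
        using that \<open>x \<in> carrier R\<close> \<open>a \<in> K'\<close> by (simp add: K'_def m_ac)
      then show ?thesis using that by (simp add: K'_def)
    qed
  qed (auto simp: K'_def l_distr zero_K add_K)
  moreover have "(\<lambda>a. a [^] p) ` I \<subseteq> K'"
  proof (rule image_subsetI)
    fix a assume "a \<in> I"
    then show "a [^] p \<in> K'"
      using pow_K[of a] T_zero \<pi>_ker[of a] I.Icarr[of a] by (auto simp: K'_def)
  qed
  ultimately have "x [^] p \<in> K'"
    using genideal_minimal assms(4) by blast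
  then have "x [^] p \<otimes> \<one> \<in> K" unfolding K'_def by blast
  then have "frag_of (\<pi> x, \<one>) \<in> T" using pow_K assms(3) by blast
  then have "T #>\<^bsub>G\<^esub> frag_of (\<pi> x, \<one>) = T #>\<^bsub>G\<^esub> frag_of (\<zero>\<^bsub>M\<^esub>, \<one>)"
    using T_zero[of \<one>] G.coset_join2[OF _ T] frag \<pi>_closed assms(3)
    by (metis M.zero_closed Pi_mem one_closed)
  then have "pure_tensor R M N (\<pi> x) \<one> = pure_tensor R M N \<zero>\<^bsub>M\<^esub> \<one>"
    by (simp add: pure_tensor_def T_def G_def)
  moreover have "inj_on (\<lambda>m. pure_tensor R M N m \<one>) (carrier M)"
    using assms(1) M unfolding F_pure_def pure_ring_map_def N_def by blast
  ultimately have "\<pi> x = \<zero>\<^bsub>M\<^esub>"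
    using \<pi>_closed assms(3) M.zero_closed by (blast dest: inj_onD)
  then show ?thesis using \<pi>_ker assms(3) by blast
qed

text \<open>Frobenius is peeled off once at a time: I^[p^(e+1)] lies in (I^[p^e])^[p], so the
  one-step result applies to the ideal I^[p^e] and the element x^(p^e).\<close>

lemma (in cring) F_pure_imp_Frobenius_closed:
  assumes "F_pure p R" "ideal I R" "x \<in> carrier R"
    and "x [^] (p ^ e) \<in> frobenius_power p R e I"
  shows "x \<in> I"
  using assms(4)
proof (induction e)
  case 0
  interpret I: ideal I R by fact
  have "Idl ((\<lambda>a. a [^] (1::nat)) ` I) \<subseteq> I"
    by (intro genideal_minimal I.is_ideal) auto
  then show ?case using 0 assms(3) by (auto simp: frobenius_power_def)
next
  case (Suc e)
  interpret I: ideal I R by fact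
  let ?J = "frobenius_power p R e I"
  interpret J: ideal ?J R by (rule frobenius_power_ideal[OF assms(2)])
  have pow: "z [^] (p ^ Suc e) = (z [^] (p ^ e)) [^] p" if "z \<in> carrier R" for z
    using that by (simp add: nat_pow_pow mult.commute)
  have "(\<lambda>a. a [^] (p ^ Suc e)) ` I \<subseteq> (\<lambda>a. a [^] p) ` ?J"
    using frobenius_power_self[OF assms(2), of _ p e] by (auto simp: pow simp del: power_Suc)
  then have "frobenius_power p R (Suc e) I \<subseteq> Idl ((\<lambda>a. a [^] p) ` ?J)"
    unfolding frobenius_power_def[of p R "Suc e"] using J.Icarr
    by (intro genideal_minimal genideal_ideal order_trans[OF _ genideal_self]) auto
  then have "x [^] (p ^ e) \<in> ?J"
    using Suc.prems pow[OF assms(3)]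
    by (intro F_pure_imp_Frobenius_closed_step[OF assms(1) J.is_ideal] nat_pow_closed assms(3)) auto
  then show ?case by (rule Suc.IH)
qed

section \<open>The bound on the test exponent for one ring map\<close>

text \<open>The exponent e depends on the map alone, hence the same bound for every ideal. As
  \<open>Fte\<close> is an infimum, it suffices that this e satisfies the defining equality.\<close>

lemma Fte_le_of_purely_inseparable:
  assumes "cring A" "cring B" "\<psi> \<in> ring_hom A B" "inj_on \<psi> (carrier A)"
    and pow: "\<And>y. y \<in> carrier B \<Longrightarrow> y [^]\<^bsub>B\<^esub> (p ^ e) \<in> \<psi> ` carrier A"
    and "F_pure p B" "ideal I A"
  shows "Fte p A I \<le> enat e"
proof -
  interpret A: cring A by fact
  interpret B: cring B by fact
  interpret \<psi>: ring_hom_ring A B \<psi>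
    by (intro ring_hom_ringI2 A.ring_axioms B.ring_axioms assms)
  interpret I: ideal I A by fact
  have frob: "frobenius p B \<in> ring_hom B B"
    using assms(6) by (simp add: F_pure_def pure_ring_map_def)
  let ?J = "frobenius_power p A e I" and ?C = "frobenius_closure p A I"
  interpret J: ideal ?J A by (rule A.frobenius_power_ideal[OF assms(7)])
  define K where "K = {y \<in> carrier B. y [^]\<^bsub>B\<^esub> (p ^ e) \<in> \<psi> ` ?J}"
  have "ideal K B"
  proof (rule B.ideal_of_closed)
    show "\<zero>\<^bsub>B\<^esub> \<in> K"
      using image_eqI[of "\<zero>\<^bsub>B\<^esub>" \<psi> "\<zero>\<^bsub>A\<^esub>" ?J]
      by (simp add: K_def B.frobenius_power_zero[OF frob])
    show "y \<oplus>\<^bsub>B\<^esub> z \<in> K" if yz: "y \<in> K" "z \<in> K" for y z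
    proof -
      obtain a b where ab: "a \<in> ?J" "b \<in> ?J" "y [^]\<^bsub>B\<^esub> (p ^ e) = \<psi> a" "z [^]\<^bsub>B\<^esub> (p ^ e) = \<psi> b"
        using yz by (auto simp: K_def)
      have "(y \<oplus>\<^bsub>B\<^esub> z) [^]\<^bsub>B\<^esub> (p ^ e) = \<psi> (a \<oplus>\<^bsub>A\<^esub> b)"
        using yz ab by (simp add: K_def B.frobenius_power_add[OF frob] J.Icarr)
      then show ?thesis using yz J.a_closed[OF ab(1,2)] by (simp add: K_def)
    qed
    \<comment> \<open>Here the exponent is used: the p^e-th power of z comes from A, so multiplying
      by it keeps the image of the ideal \<open>?J\<close> of A inside itself.\<close>
    show "z \<otimes>\<^bsub>B\<^esub> y \<in> K" if zy: "z \<in> carrier B" "y \<in> K" for z y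
    proof -
      obtain a c where ac: "a \<in> ?J" "y [^]\<^bsub>B\<^esub> (p ^ e) = \<psi> a"
        "c \<in> carrier A" "z [^]\<^bsub>B\<^esub> (p ^ e) = \<psi> c"
        using zy pow[OF zy(1)] by (auto simp: K_def)
      have "(z \<otimes>\<^bsub>B\<^esub> y) [^]\<^bsub>B\<^esub> (p ^ e) = \<psi> (c \<otimes>\<^bsub>A\<^esub> a)"
        using zy ac by (simp add: K_def B.nat_pow_distrib J.Icarr)
      then show ?thesis using zy J.I_l_closed[OF ac(1,3)] by (simp add: K_def)
    qed
  qed (auto simp: K_def)
  have \<psi>_K: "\<psi> a \<in> K" if "a \<in> I" for a
    using that A.frobenius_power_self[OF assms(7) that, of p e]
    by (auto simp: K_def I.Icarr \<psi>.hom_nat_pow[symmetric])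
  have closure_pow: "x [^]\<^bsub>A\<^esub> (p ^ e) \<in> ?J" if C: "x \<in> ?C" for x
  proof -
    obtain e' where x: "x \<in> carrier A" and e': "x [^]\<^bsub>A\<^esub> (p ^ e') \<in> frobenius_power p A e' I"
      using C by (auto simp: frobenius_closure_def)
    let ?W = "frobenius_power p B e' K"
    \<comment> \<open>The preimage of K^[p^e'] is an ideal containing the generators of I^[p^e'], so
      \<open>\<psi>\<close> carries the Frobenius closure of I into that of K, which is K.\<close>
    have "ideal {a \<in> carrier A. \<psi> a \<in> ?W} A"
      by (intro \<psi>.ideal_vimage B.frobenius_power_ideal \<open>ideal K B\<close>)
    moreover have "(\<lambda>a. a [^]\<^bsub>A\<^esub> (p ^ e')) ` I \<subseteq> {a \<in> carrier A. \<psi> a \<in> ?W}"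
      using \<psi>_K B.frobenius_power_self[OF \<open>ideal K B\<close>]
      by (auto simp: I.Icarr \<psi>.hom_nat_pow)
    ultimately have "frobenius_power p A e' I \<subseteq> {a \<in> carrier A. \<psi> a \<in> ?W}"
      unfolding frobenius_power_def[of p A] by (rule A.genideal_minimal)
    then have "\<psi> x [^]\<^bsub>B\<^esub> (p ^ e') \<in> ?W"
      using e' x by (auto simp: \<psi>.hom_nat_pow)
    then have "\<psi> x \<in> K"
      by (rule B.F_pure_imp_Frobenius_closed[OF assms(6) \<open>ideal K B\<close> \<psi>.hom_closed[OF x]])
    then have "\<psi> (x [^]\<^bsub>A\<^esub> (p ^ e)) \<in> \<psi> ` ?J"
      using x by (simp add: K_def \<psi>.hom_nat_pow)
    then show ?thesis
      using assms(4) x J.Icarr by (auto dest!: inj_onD)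
  qed
  have "I \<subseteq> ?C"
    using A.frobenius_power_self[OF assms(7), of _ p 0]
    by (auto simp: frobenius_closure_def I.Icarr intro!: exI[of _ 0])
  have "frobenius_power p A e ?C = ?J"
  proof
    show "frobenius_power p A e ?C \<subseteq> ?J"
      unfolding frobenius_power_def[of p A e ?C]
      using closure_pow by (intro A.genideal_minimal J.is_ideal) auto
    have "(\<lambda>a. a [^]\<^bsub>A\<^esub> (p ^ e)) ` ?C \<subseteq> carrier A"
      by (auto simp: frobenius_closure_def)
    then show "?J \<subseteq> frobenius_power p A e ?C"
      unfolding frobenius_power_def using \<open>I \<subseteq> ?C\<close>
      by (intro A.genideal_minimal A.genideal_ideal order_trans[OF _ A.genideal_self]) auto
  qed
  then show ?thesis unfolding Fte_def by (intro Inf_lower) auto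
qed

section \<open>Localizing a ring map\<close>

lemma (in mult_closed) pow_D: "s \<in> D \<Longrightarrow> s [^] (n::nat) \<in> D"
  by (induction n) (auto intro: one_D mult_D)

lemma (in mult_closed) fraction_pow:
  assumes "a \<in> carrier A" "s \<in> D"
  shows "fraction A D a s [^]\<^bsub>localization A D\<^esub> (n::nat) = fraction A D (a [^] n) (s [^] n)"
  using assms by (induction n) (simp_all add: localization_one localization_mult pow_D)

lemma (in mult_closed) localizationE:
  assumes "x \<in> carrier (localization A D)"
  obtains a s where "a \<in> carrier A" "s \<in> D" "x = fraction A D a s"
  using assms by (auto simp: fraction_carrier)

text \<open>The formula of \<open>localized_map\<close> with the denominators E of the target left
  free, so that E may also be the complement of a prime of S.\<close>

definition fraction_map ::
    "('b, 's) ring_scheme \<Rightarrow> 'b set \<Rightarrow> ('a \<Rightarrow> 'b) \<Rightarrow> ('a \<times> 'a) set \<Rightarrow> ('b \<times> 'b) set" where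
  "fraction_map B E \<phi> x = (\<Union>(a, s)\<in>x. fraction B E (\<phi> a) (\<phi> s))"

locale localized_hom = A: mult_closed A D + B: mult_closed B E
  for A :: "('a, 'r) ring_scheme" and D and B :: "('b, 's) ring_scheme" and E +
  fixes \<phi> :: "'a \<Rightarrow> 'b"
  assumes hom: "\<phi> \<in> ring_hom A B" and image: "\<phi> ` D \<subseteq> E"
begin

sublocale \<phi>: ring_hom_ring A B \<phi>
  by (intro ring_hom_ringI2 A.ring_axioms B.ring_axioms hom)

lemma image_D: "s \<in> D \<Longrightarrow> \<phi> s \<in> E"
  using image by blast

text \<open>The image does not depend on the representative, so the union defining the map is a
  union of copies of one class.\<close>

lemma fraction_map_fraction:
  assumes "a \<in> carrier A" "s \<in> D"
  shows "fraction_map B E \<phi> (fraction A D a s) = fraction B E (\<phi> a) (\<phi> s)"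
proof -
  have *: "fraction B E (\<phi> b) (\<phi> t) = fraction B E (\<phi> a) (\<phi> s)"
    if bt: "(b, t) \<in> fraction A D a s" for b t
  proof -
    obtain u where u: "u \<in> D" "u \<otimes>\<^bsub>A\<^esub> (t \<otimes>\<^bsub>A\<^esub> a) = u \<otimes>\<^bsub>A\<^esub> (s \<otimes>\<^bsub>A\<^esub> b)"
      and D: "b \<in> carrier A" "t \<in> D"
      using bt by (auto simp: A.fraction_mem A.fraction_rel_iff)
    have "\<phi> u \<otimes>\<^bsub>B\<^esub> (\<phi> t \<otimes>\<^bsub>B\<^esub> \<phi> a) = \<phi> u \<otimes>\<^bsub>B\<^esub> (\<phi> s \<otimes>\<^bsub>B\<^esub> \<phi> b)"
      using arg_cong[OF u(2), of \<phi>] u(1) D assms by simp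
    then show ?thesis
      using assms D u(1) by (subst B.fraction_eq_iff) (auto simp: image_D intro!: bexI[of _ "\<phi> u"])
  qed
  have "fraction_map B E \<phi> (fraction A D a s) = (\<Union>_\<in>fraction A D a s. fraction B E (\<phi> a) (\<phi> s))"
    unfolding fraction_map_def by (intro SUP_cong refl) (auto simp only: * split: prod.splits)
  also have "\<dots> = fraction B E (\<phi> a) (\<phi> s)"
    using A.fraction_self[OF assms] by auto
  finally show ?thesis .
qed

lemma fraction_map_hom: "fraction_map B E \<phi> \<in> ring_hom (localization A D) (localization B E)"
proof (rule ring_hom_memI)
  fix x y assume "x \<in> carrier (localization A D)" "y \<in> carrier (localization A D)"
  then obtain a s b t where *: "a \<in> carrier A" "s \<in> D" "x = fraction A D a s"
    "b \<in> carrier A" "t \<in> D" "y = fraction A D b t"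
    by (elim A.localizationE)
  show "fraction_map B E \<phi> (x \<otimes>\<^bsub>localization A D\<^esub> y) =
      fraction_map B E \<phi> x \<otimes>\<^bsub>localization B E\<^esub> fraction_map B E \<phi> y"
    using * by (simp add: A.localization_mult B.localization_mult A.mult_D fraction_map_fraction image_D)
  show "fraction_map B E \<phi> (x \<oplus>\<^bsub>localization A D\<^esub> y) =
      fraction_map B E \<phi> x \<oplus>\<^bsub>localization B E\<^esub> fraction_map B E \<phi> y"
    using * by (simp add: A.localization_add B.localization_add A.mult_D fraction_map_fraction image_D)
next
  fix x assume "x \<in> carrier (localization A D)"
  then show "fraction_map B E \<phi> x \<in> carrier (localization B E)"
    by (elim A.localizationE) (simp add: fraction_map_fraction B.fraction_closed image_D)
qed (simp add: A.localization_one B.localization_one fraction_map_fraction A.one_D)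

text \<open>Equality of images is an equality in B after multiplication by some u in E. The
  hypothesis \<open>torsion\<close> replaces u by a multiple coming from D, and injectivity of
  \<open>\<phi>\<close> then pulls the equality back to A.\<close>

lemma fraction_map_inj:
  assumes "inj_on \<phi> (carrier A)"
    and torsion: "\<And>t. t \<in> E \<Longrightarrow> \<exists>w\<in>carrier B. \<exists>r\<in>D. w \<otimes>\<^bsub>B\<^esub> t = \<phi> r"
  shows "inj_on (fraction_map B E \<phi>) (carrier (localization A D))"
proof (rule inj_onI)
  fix x y assume xy: "x \<in> carrier (localization A D)" "y \<in> carrier (localization A D)"
    "fraction_map B E \<phi> x = fraction_map B E \<phi> y"
  then obtain a s b t where *: "a \<in> carrier A" "s \<in> D" "x = fraction A D a s"
    "b \<in> carrier A" "t \<in> D" "y = fraction A D b t"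
    by (elim A.localizationE)
  obtain u where u: "u \<in> E" "u \<otimes>\<^bsub>B\<^esub> (\<phi> t \<otimes>\<^bsub>B\<^esub> \<phi> a) = u \<otimes>\<^bsub>B\<^esub> (\<phi> s \<otimes>\<^bsub>B\<^esub> \<phi> b)"
    using xy(3) * by (auto simp: fraction_map_fraction B.fraction_eq_iff image_D)
  obtain w r where w: "w \<in> carrier B" "r \<in> D" "w \<otimes>\<^bsub>B\<^esub> u = \<phi> r"
    using torsion[OF u(1)] by blast
  have "\<phi> (r \<otimes>\<^bsub>A\<^esub> (t \<otimes>\<^bsub>A\<^esub> a)) = w \<otimes>\<^bsub>B\<^esub> (u \<otimes>\<^bsub>B\<^esub> (\<phi> t \<otimes>\<^bsub>B\<^esub> \<phi> a))"
    using * w u(1) by (simp add: w(3)[symmetric] B.m_assoc)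
  also have "\<dots> = \<phi> (r \<otimes>\<^bsub>A\<^esub> (s \<otimes>\<^bsub>A\<^esub> b))"
    unfolding u(2) using * w u(1) by (simp add: w(3)[symmetric] B.m_assoc)
  finally have "r \<otimes>\<^bsub>A\<^esub> (t \<otimes>\<^bsub>A\<^esub> a) = r \<otimes>\<^bsub>A\<^esub> (s \<otimes>\<^bsub>A\<^esub> b)"
    using assms(1) * w(2) by (intro inj_onD[OF assms(1)]) auto
  then show "x = y"
    using * w(2) by (auto simp: A.fraction_eq_iff)
qed

text \<open>Expanding b / t by w gives \<open>\<phi> a\<close> / \<open>\<phi> s\<close>.\<close>

lemma fraction_map_image:
  assumes "b \<in> carrier B" "t \<in> E" "w \<in> E" "a \<in> carrier A" "s \<in> D"
    and "w \<otimes>\<^bsub>B\<^esub> b = \<phi> a" "w \<otimes>\<^bsub>B\<^esub> t = \<phi> s"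
  shows "fraction B E b t \<in> fraction_map B E \<phi> ` carrier (localization A D)"
proof (rule image_eqI)
  have "\<phi> s \<otimes>\<^bsub>B\<^esub> b = t \<otimes>\<^bsub>B\<^esub> \<phi> a"
    unfolding assms(6,7)[symmetric] using assms(1-3) by (simp add: B.m_ac)
  then show "fraction B E b t = fraction_map B E \<phi> (fraction A D a s)"
    unfolding fraction_map_fraction[OF assms(4,5)] using assms(1,2,4,5)
    by (intro B.fraction_eqI image_D) auto
  show "fraction A D a s \<in> carrier (localization A D)"
    using assms(4,5) by (rule A.fraction_closed)
qed

end

section \<open>The ideals measuring inseparability\<close>

locale frobenius_extension = R: cring R + S: cring S
  for R :: "('a, 'r) ring_scheme" and S :: "('b, 's) ring_scheme" +
  fixes \<phi> :: "'a \<Rightarrow> 'b" and p :: nat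
  assumes hom: "\<phi> \<in> ring_hom R S" and inj: "inj_on \<phi> (carrier R)"
    and frobenius_hom: "frobenius p S \<in> ring_hom S S" and p_pos: "0 < p"
begin

lemma p_power_Suc: obtains k where "p ^ e = Suc k"
  using p_pos by (metis gr0_conv_Suc zero_less_power)

sublocale \<phi>: ring_hom_ring R S \<phi>
  by (intro ring_hom_ringI2 R.ring_axioms S.ring_axioms hom)

text \<open>The factor u stands inside the power so that the sets increase with e: powers of
  elements of R stay in R. With u s^(p^e) in its place, passing from e to e + 1 would turn u into
  u^p.\<close>

definition inseparability_ideal :: "nat \<Rightarrow> 'a set" where
  "inseparability_ideal e =
     {u \<in> carrier R. \<forall>s\<in>carrier S. (\<phi> u \<otimes>\<^bsub>S\<^esub> s) [^]\<^bsub>S\<^esub> (p ^ e) \<in> \<phi> ` carrier R}"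

lemma image_add: "x \<in> \<phi> ` carrier R \<Longrightarrow> y \<in> \<phi> ` carrier R \<Longrightarrow> x \<oplus>\<^bsub>S\<^esub> y \<in> \<phi> ` carrier R"
  by (metis (no_types, lifting) R.a_closed \<phi>.hom_add imageE imageI)

lemma image_mult: "x \<in> \<phi> ` carrier R \<Longrightarrow> y \<in> \<phi> ` carrier R \<Longrightarrow> x \<otimes>\<^bsub>S\<^esub> y \<in> \<phi> ` carrier R"
  by (metis (no_types, lifting) R.m_closed \<phi>.hom_mult imageE imageI)

lemma image_pow: "x \<in> \<phi> ` carrier R \<Longrightarrow> x [^]\<^bsub>S\<^esub> (n::nat) \<in> \<phi> ` carrier R"
  by (metis (no_types, lifting) R.nat_pow_closed \<phi>.hom_nat_pow imageE imageI)

lemma image_pow_mono: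
  assumes "s \<in> carrier S" "s [^]\<^bsub>S\<^esub> (p ^ e) \<in> \<phi> ` carrier R" "e \<le> e'"
  shows "s [^]\<^bsub>S\<^esub> (p ^ e') \<in> \<phi> ` carrier R"
proof -
  have "s [^]\<^bsub>S\<^esub> (p ^ e') = (s [^]\<^bsub>S\<^esub> (p ^ e)) [^]\<^bsub>S\<^esub> (p ^ (e' - e))"
    using assms(1,3) by (simp add: S.nat_pow_pow flip: power_add)
  then show ?thesis using image_pow[OF assms(2)] by simp
qed

text \<open>Since s runs over all of S, a scalar r can be absorbed into s; sums are handled by
  additivity of Frobenius.\<close>

lemma inseparability_ideal_ideal: "ideal (inseparability_ideal e) R"
proof (rule R.ideal_of_closed)
  show "\<zero>\<^bsub>R\<^esub> \<in> inseparability_ideal e"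
    using S.frobenius_power_zero[OF frobenius_hom, of e] image_eqI[of "\<zero>\<^bsub>S\<^esub>" \<phi> "\<zero>\<^bsub>R\<^esub>"]
    by (simp add: inseparability_ideal_def)
  show "u \<oplus>\<^bsub>R\<^esub> v \<in> inseparability_ideal e"
    if "u \<in> inseparability_ideal e" "v \<in> inseparability_ideal e" for u v
    using that
    by (auto simp: inseparability_ideal_def S.l_distr S.frobenius_power_add[OF frobenius_hom]
        intro: image_add)
  show "r \<otimes>\<^bsub>R\<^esub> u \<in> inseparability_ideal e"
    if "r \<in> carrier R" "u \<in> inseparability_ideal e" for r u
  proof -
    have "\<phi> (r \<otimes>\<^bsub>R\<^esub> u) \<otimes>\<^bsub>S\<^esub> s = \<phi> u \<otimes>\<^bsub>S\<^esub> (\<phi> r \<otimes>\<^bsub>S\<^esub> s)" if "s \<in> carrier S" for s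
      using that \<open>r \<in> carrier R\<close> \<open>u \<in> inseparability_ideal e\<close>
      by (simp add: inseparability_ideal_def S.m_ac)
    then show ?thesis using that by (simp add: inseparability_ideal_def)
  qed
qed (auto simp: inseparability_ideal_def)

lemma inseparability_ideal_mono: "e \<le> e' \<Longrightarrow> inseparability_ideal e \<subseteq> inseparability_ideal e'"
  unfolding inseparability_ideal_def
  by (intro subsetI CollectI conjI ballI image_pow_mono[of _ e e']) auto

lemma inseparability_ideal_stabilizes:
  assumes "noetherian_ring R"
  obtains e0 where "\<And>e. inseparability_ideal e \<subseteq> inseparability_ideal e0"
proof -
  have "subset.chain {I. ideal I R} (range inseparability_ideal)"
    unfolding subset_chain_def
    using inseparability_ideal_ideal inseparability_ideal_mono by (auto intro: nat_le_linear)
       (metis inseparability_ideal_mono nat_le_linear subsetD)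
  then have "\<Union>(range inseparability_ideal) \<in> range inseparability_ideal"
    by (intro noetherian_ring.ideal_chain_is_trivial[OF assms]) auto
  then obtain e0 where "\<Union>(range inseparability_ideal) = inseparability_ideal e0" by blast
  then show thesis using that by blast
qed

text \<open>With q = p^e, the q-th power of v times the sum of c_a a is the sum of the terms c_a^q
  (v a)^q. Hence membership in the image of R has to be tested on module generators only.\<close>

lemma pow_image_submodule:
  assumes "A \<subseteq> carrier S" "c \<in> A \<rightarrow> carrier R" "v \<in> carrier R"
    and "\<forall>a\<in>A. (\<phi> v \<otimes>\<^bsub>S\<^esub> a) [^]\<^bsub>S\<^esub> (p ^ e) \<in> \<phi> ` carrier R" and "finite A"
  shows "(\<phi> v \<otimes>\<^bsub>S\<^esub> (\<Oplus>\<^bsub>S\<^esub>a\<in>A. \<phi> (c a) \<otimes>\<^bsub>S\<^esub> a)) [^]\<^bsub>S\<^esub> (p ^ e) \<in> \<phi> ` carrier R"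
  using assms(5,1-4)
proof (induction A rule: finite_induct)
  case empty
  then show ?case
    using S.frobenius_power_zero[OF frobenius_hom, of e] image_eqI[of "\<zero>\<^bsub>S\<^esub>" \<phi> "\<zero>\<^bsub>R\<^esub>"] by simp
next
  case (insert a A)
  have closed: "(\<lambda>a. \<phi> (c a) \<otimes>\<^bsub>S\<^esub> a) \<in> A \<rightarrow> carrier S" and a: "a \<in> carrier S" "c a \<in> carrier R"
    using insert.prems by (auto simp: Pi_iff)
  have "(\<phi> v \<otimes>\<^bsub>S\<^esub> (\<phi> (c a) \<otimes>\<^bsub>S\<^esub> a)) [^]\<^bsub>S\<^esub> (p ^ e) =
      \<phi> (c a) [^]\<^bsub>S\<^esub> (p ^ e) \<otimes>\<^bsub>S\<^esub> (\<phi> v \<otimes>\<^bsub>S\<^esub> a) [^]\<^bsub>S\<^esub> (p ^ e)"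
    using a insert.prems(3) by (simp add: S.nat_pow_distrib[symmetric] S.m_ac)
  then have "(\<phi> v \<otimes>\<^bsub>S\<^esub> (\<phi> (c a) \<otimes>\<^bsub>S\<^esub> a)) [^]\<^bsub>S\<^esub> (p ^ e) \<in> \<phi> ` carrier R"
    using image_mult[OF image_pow[OF imageI[OF a(2)]]] insert.prems(4) by simp
  moreover have "(\<phi> v \<otimes>\<^bsub>S\<^esub> (\<Oplus>\<^bsub>S\<^esub>a\<in>A. \<phi> (c a) \<otimes>\<^bsub>S\<^esub> a)) [^]\<^bsub>S\<^esub> (p ^ e) \<in> \<phi> ` carrier R"
    using insert by auto
  moreover have "(\<Oplus>\<^bsub>S\<^esub>a\<in>insert a A. \<phi> (c a) \<otimes>\<^bsub>S\<^esub> a) =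
      \<phi> (c a) \<otimes>\<^bsub>S\<^esub> a \<oplus>\<^bsub>S\<^esub> (\<Oplus>\<^bsub>S\<^esub>a\<in>A. \<phi> (c a) \<otimes>\<^bsub>S\<^esub> a)"
    using insert.hyps closed a by (intro S.finsum_insert) auto
  ultimately show ?case
    using a closed insert.prems(3) S.finsum_closed[OF closed]
    by (simp add: S.r_distr S.frobenius_power_add[OF frobenius_hom] image_add)
qed

section \<open>Localization at a single prime of R\<close>

context
  fixes P assumes P: "P \<in> Spec R"
begin

interpretation P: primeideal P R
  using P by (simp add: Spec_def)

lemma localized_hom_at:
  assumes "mult_closed S E" "\<phi> ` (carrier R - P) \<subseteq> E"
  shows "localized_hom R (carrier R - P) S E \<phi>"
  using assms P.mult_closed_complement hom by (intro localized_hom.intro localized_hom_axioms.intro)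

lemma base_change_mult_closed: "mult_closed S (\<phi> ` (carrier R - P))"
proof -
  interpret D: mult_closed R "carrier R - P" by (rule P.mult_closed_complement)
  show ?thesis
  proof
    show "\<one>\<^bsub>S\<^esub> \<in> \<phi> ` (carrier R - P)"
      using D.one_D \<phi>.hom_one by (metis imageI)
    show "s \<otimes>\<^bsub>S\<^esub> t \<in> \<phi> ` (carrier R - P)"
      if st: "s \<in> \<phi> ` (carrier R - P)" "t \<in> \<phi> ` (carrier R - P)" for s t
    proof -
      obtain a b where ab: "a \<in> carrier R - P" "s = \<phi> a" "b \<in> carrier R - P" "t = \<phi> b"
        using st by (elim imageE) auto
      then have "s \<otimes>\<^bsub>S\<^esub> t = \<phi> (a \<otimes>\<^bsub>R\<^esub> b)" by simp
      then show ?thesis using D.mult_D[OF ab(1,3)] by (rule image_eqI)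
    qed
  qed auto
qed

text \<open>The two sets E of interest are the image of the complement of P and the complement of the
  prime of S over P.\<close>

lemma localized_purely_inseparable:
  assumes u: "u \<in> inseparability_ideal e" "u \<notin> P"
    and E: "mult_closed S E" "\<phi> ` (carrier R - P) \<subseteq> E"
    and disjoint: "\<forall>r\<in>carrier R. \<phi> r \<in> E \<longrightarrow> r \<notin> P"
  shows "fraction_map S E \<phi> \<in> ring_hom (localization_at R P) (localization S E)"
    and "inj_on (fraction_map S E \<phi>) (carrier (localization_at R P))"
    and "y \<in> carrier (localization S E) \<Longrightarrow>
      y [^]\<^bsub>localization S E\<^esub> (p ^ e) \<in> fraction_map S E \<phi> ` carrier (localization_at R P)"
proof -
  interpret L: localized_hom R "carrier R - P" S E \<phi>
    by (rule localized_hom_at[OF E])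
  have uR: "u \<in> carrier R" and u_pow: "\<And>s. s \<in> carrier S \<Longrightarrow> (\<phi> u \<otimes>\<^bsub>S\<^esub> s) [^]\<^bsub>S\<^esub> (p ^ e) \<in> \<phi> ` carrier R"
    using u(1) by (auto simp: inseparability_ideal_def)
  have uE: "\<phi> u \<in> E" using u(2) uR E(2) by blast
  \<comment> \<open>The power lies in the image of R by the choice of u, and in E because u and t
    do; by \<open>disjoint\<close> its preimage then avoids P.\<close>
  have denominator: "\<exists>r\<in>carrier R - P. (\<phi> u \<otimes>\<^bsub>S\<^esub> t) [^]\<^bsub>S\<^esub> (p ^ e) = \<phi> r" if t: "t \<in> E" for t
  proof -
    obtain r where r: "r \<in> carrier R" "(\<phi> u \<otimes>\<^bsub>S\<^esub> t) [^]\<^bsub>S\<^esub> (p ^ e) = \<phi> r"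
      using u_pow[of t] t by auto
    have "\<phi> r \<in> E" unfolding r(2)[symmetric] by (intro L.B.pow_D L.B.mult_D uE t)
    then show ?thesis using r disjoint by blast
  qed
  show "fraction_map S E \<phi> \<in> ring_hom (localization_at R P) (localization S E)"
    unfolding localization_at_def by (rule L.fraction_map_hom)
  show "inj_on (fraction_map S E \<phi>) (carrier (localization_at R P))"
    unfolding localization_at_def
  proof (rule L.fraction_map_inj[OF inj])
    fix t assume t: "t \<in> E"
    obtain r where r: "r \<in> carrier R - P" "(\<phi> u \<otimes>\<^bsub>S\<^esub> t) [^]\<^bsub>S\<^esub> (p ^ e) = \<phi> r"
      using denominator[OF t] by blast
    show "\<exists>w\<in>carrier S. \<exists>r\<in>carrier R - P. w \<otimes>\<^bsub>S\<^esub> t = \<phi> r"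
    proof -
      \<comment> \<open>A positive exponent lets one factor be split off, which exhibits the power
        as a multiple of t.\<close>
      obtain k where Suc: "p ^ e = Suc k" by (rule p_power_Suc)
      have "((\<phi> u \<otimes>\<^bsub>S\<^esub> t) [^]\<^bsub>S\<^esub> k \<otimes>\<^bsub>S\<^esub> \<phi> u) \<otimes>\<^bsub>S\<^esub> t = \<phi> r"
        using r(2) t uE by (simp add: Suc S.m_assoc)
      then show ?thesis using r(1) t uE by (intro bexI) auto
    qed
  qed
  assume "y \<in> carrier (localization S E)"
  then obtain s t where y: "s \<in> carrier S" "t \<in> E" "y = fraction S E s t"
    by (elim L.B.localizationE)
  obtain a where a: "a \<in> carrier R" "(\<phi> u \<otimes>\<^bsub>S\<^esub> s) [^]\<^bsub>S\<^esub> (p ^ e) = \<phi> a"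
    using u_pow[OF y(1)] by auto
  obtain r where r: "r \<in> carrier R - P" "(\<phi> u \<otimes>\<^bsub>S\<^esub> t) [^]\<^bsub>S\<^esub> (p ^ e) = \<phi> r"
    using denominator[OF y(2)] by blast
  \<comment> \<open>Expansion by \<open>\<phi> u\<close> to the power p^e makes numerator and
    denominator come from R.\<close>
  have "fraction S E (s [^]\<^bsub>S\<^esub> (p ^ e)) (t [^]\<^bsub>S\<^esub> (p ^ e))
      \<in> fraction_map S E \<phi> ` carrier (localization R (carrier R - P))"
    using a r y uE L.B.pow_D
    by (intro L.fraction_map_image[of _ _ "\<phi> u [^]\<^bsub>S\<^esub> (p ^ e)" a r]) (auto simp: S.nat_pow_distrib)
  then show "y [^]\<^bsub>localization S E\<^esub> (p ^ e) \<in> fraction_map S E \<phi> ` carrier (localization_at R P)"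
    using y by (simp add: L.B.fraction_pow localization_at_def)
qed

text \<open>Each element of S has its own exponent and its own multiplier outside P. For finitely
  many module generators the product of the multipliers and the maximum of the exponents work at
  once, and additivity of Frobenius extends this to all of S.\<close>

lemma purely_inseparable_locus_imp:
  assumes "finite_ring_map R S \<phi>" "P \<in> purely_inseparable_locus p R S \<phi>"
  obtains e where "\<not> inseparability_ideal e \<subseteq> P"
proof -
  let ?E = "\<phi> ` (carrier R - P)"
  interpret L: localized_hom R "carrier R - P" S ?E \<phi>
    by (rule localized_hom_at[OF base_change_mult_closed order_refl])
  have local: "\<exists>v\<in>carrier R - P. \<exists>e. (\<phi> v \<otimes>\<^bsub>S\<^esub> s) [^]\<^bsub>S\<^esub> (p ^ e) \<in> \<phi> ` carrier R"
    if s: "s \<in> carrier S" for s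
  proof -
    have "fraction S ?E s \<one>\<^bsub>S\<^esub> \<in> carrier (base_change_at R S \<phi> P)"
      unfolding base_change_at_def using s L.B.one_D by (rule L.B.fraction_closed)
    then obtain e where "fraction S ?E s \<one>\<^bsub>S\<^esub> [^]\<^bsub>localization S ?E\<^esub> (p ^ e)
        \<in> localized_map R S \<phi> P ` carrier (localization_at R P)"
      using assms(2) unfolding purely_inseparable_locus_def purely_inseparable_def base_change_at_def
      by blast
    then obtain x where x: "x \<in> carrier (localization R (carrier R - P))"
      "fraction S ?E (s [^]\<^bsub>S\<^esub> (p ^ e)) \<one>\<^bsub>S\<^esub> = fraction_map S ?E \<phi> x"
      using s L.B.one_D
      by (auto simp: L.B.fraction_pow localized_map_def fraction_map_def localization_at_def)
    then obtain a t where a: "a \<in> carrier R" "t \<in> carrier R - P"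
      "fraction S ?E (s [^]\<^bsub>S\<^esub> (p ^ e)) \<one>\<^bsub>S\<^esub> = fraction S ?E (\<phi> a) (\<phi> t)"
      by (elim L.A.localizationE) (auto simp: L.fraction_map_fraction)
    obtain w where w: "w \<in> carrier R - P"
      "\<phi> w \<otimes>\<^bsub>S\<^esub> (\<phi> t \<otimes>\<^bsub>S\<^esub> s [^]\<^bsub>S\<^esub> (p ^ e)) = \<phi> w \<otimes>\<^bsub>S\<^esub> (\<one>\<^bsub>S\<^esub> \<otimes>\<^bsub>S\<^esub> \<phi> a)"
      using a s L.B.one_D by (subst (asm) L.B.fraction_eq_iff) auto
    \<comment> \<open>Clearing denominators: w t s^(p^e) lies in the image of R.\<close>
    let ?v = "w \<otimes>\<^bsub>R\<^esub> t"
    have v: "?v \<in> carrier R - P" using w a by (intro L.A.mult_D)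
    have eq: "\<phi> ?v \<otimes>\<^bsub>S\<^esub> s [^]\<^bsub>S\<^esub> (p ^ e) = \<phi> (w \<otimes>\<^bsub>R\<^esub> a)"
      using w a s by (simp add: S.m_assoc)
    have "(\<phi> ?v \<otimes>\<^bsub>S\<^esub> s) [^]\<^bsub>S\<^esub> (p ^ e) \<in> \<phi> ` carrier R"
    proof -
      \<comment> \<open>With q = p^e positive, (v s)^q = v^(q-1) (v s^q) moves the multiplier inside
        the power, the form required by \<open>inseparability_ideal\<close>.\<close>
      obtain k where Suc: "p ^ e = Suc k" by (rule p_power_Suc)
      have vS: "\<phi> ?v \<in> carrier S" using v by (intro \<phi>.hom_closed) auto
      have "(\<phi> ?v \<otimes>\<^bsub>S\<^esub> s) [^]\<^bsub>S\<^esub> (p ^ e) = \<phi> ?v [^]\<^bsub>S\<^esub> k \<otimes>\<^bsub>S\<^esub> (\<phi> ?v \<otimes>\<^bsub>S\<^esub> s [^]\<^bsub>S\<^esub> (p ^ e))"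
        unfolding S.nat_pow_distrib[OF vS s] using vS s by (simp add: Suc S.m_assoc)
      then show ?thesis
        unfolding eq using v w a by (auto intro!: image_mult image_pow)
    qed
    then show ?thesis using v by blast
  qed
  obtain A where A: "finite A" "A \<subseteq> carrier S"
    and gen: "\<And>s. s \<in> carrier S \<Longrightarrow>
      \<exists>c\<in>A \<rightarrow> carrier R. s = (\<Oplus>\<^bsub>restrict_scalars \<phi> S\<^esub>a\<in>A. c a \<odot>\<^bsub>restrict_scalars \<phi> S\<^esub> a)"
    using assms(1) unfolding finite_ring_map_def finitely_generated_module_def
    by (auto simp: restrict_scalars_def)
  have "\<exists>v\<in>carrier R - P. \<exists>e. \<forall>a\<in>A. (\<phi> v \<otimes>\<^bsub>S\<^esub> a) [^]\<^bsub>S\<^esub> (p ^ e) \<in> \<phi> ` carrier R"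
    using A
  proof (induction A rule: finite_induct)
    case empty
    then show ?case using L.A.one_D by auto
  next
    case (insert b A)
    obtain v e where v: "v \<in> carrier R - P"
      "\<forall>a\<in>A. (\<phi> v \<otimes>\<^bsub>S\<^esub> a) [^]\<^bsub>S\<^esub> (p ^ e) \<in> \<phi> ` carrier R"
      using insert by auto
    obtain w e' where w: "w \<in> carrier R - P"
      "(\<phi> w \<otimes>\<^bsub>S\<^esub> b) [^]\<^bsub>S\<^esub> (p ^ e') \<in> \<phi> ` carrier R"
      using local[of b] insert.prems by auto
    \<comment> \<open>Membership survives a further factor from R and a larger exponent, so both
      sets of data pass to v w and \<open>max e e'\<close>.\<close>
    have mult: "(\<phi> (x \<otimes>\<^bsub>R\<^esub> y) \<otimes>\<^bsub>S\<^esub> s) [^]\<^bsub>S\<^esub> (p ^ max e e') \<in> \<phi> ` carrier R"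
      if "(\<phi> y \<otimes>\<^bsub>S\<^esub> s) [^]\<^bsub>S\<^esub> (p ^ d) \<in> \<phi> ` carrier R" "d \<le> max e e'"
        "x \<in> carrier R" "y \<in> carrier R" "s \<in> carrier S" for x y s d
    proof -
      have "(\<phi> y \<otimes>\<^bsub>S\<^esub> s) [^]\<^bsub>S\<^esub> (p ^ max e e') \<in> \<phi> ` carrier R"
        using that(4,5) by (intro image_pow_mono[OF _ that(1,2)]) simp
      moreover have "\<phi> (x \<otimes>\<^bsub>R\<^esub> y) \<otimes>\<^bsub>S\<^esub> s = \<phi> x \<otimes>\<^bsub>S\<^esub> (\<phi> y \<otimes>\<^bsub>S\<^esub> s)"
        using that by (simp add: S.m_assoc)
      ultimately show ?thesis
        using image_mult[OF image_pow[OF imageI[OF that(3)]]] that(3-5) by (simp add: S.nat_pow_distrib)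
    qed
    have "\<forall>a\<in>insert b A. (\<phi> (v \<otimes>\<^bsub>R\<^esub> w) \<otimes>\<^bsub>S\<^esub> a) [^]\<^bsub>S\<^esub> (p ^ max e e') \<in> \<phi> ` carrier R"
    proof
      fix a assume a: "a \<in> insert b A"
      show "(\<phi> (v \<otimes>\<^bsub>R\<^esub> w) \<otimes>\<^bsub>S\<^esub> a) [^]\<^bsub>S\<^esub> (p ^ max e e') \<in> \<phi> ` carrier R"
      proof (cases "a = b")
        case True
        then show ?thesis using mult[OF w(2), of v] v(1) w(1) insert.prems by simp
      next
        case False
        then have "(\<phi> (w \<otimes>\<^bsub>R\<^esub> v) \<otimes>\<^bsub>S\<^esub> a) [^]\<^bsub>S\<^esub> (p ^ max e e') \<in> \<phi> ` carrier R"
          using mult[of v a e w] v w(1) insert.prems a by simp blast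
        then show ?thesis using v w by (simp add: R.m_comm)
      qed
    qed
    then show ?case using L.A.mult_D[OF v(1) w(1)] by blast
  qed
  then obtain v e where v: "v \<in> carrier R - P"
    "\<forall>a\<in>A. (\<phi> v \<otimes>\<^bsub>S\<^esub> a) [^]\<^bsub>S\<^esub> (p ^ e) \<in> \<phi> ` carrier R"
    by blast
  have "(\<phi> v \<otimes>\<^bsub>S\<^esub> s) [^]\<^bsub>S\<^esub> (p ^ e) \<in> \<phi> ` carrier R" if s: "s \<in> carrier S" for s
  proof -
    obtain c where c: "c \<in> A \<rightarrow> carrier R"
      "s = (\<Oplus>\<^bsub>restrict_scalars \<phi> S\<^esub>a\<in>A. c a \<odot>\<^bsub>restrict_scalars \<phi> S\<^esub> a)"
      using gen[OF s] by blast
    \<comment> \<open>Restriction of scalars leaves addition unchanged, so the two sums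
      agree.\<close>
    have "s = (\<Oplus>\<^bsub>S\<^esub>a\<in>A. \<phi> (c a) \<otimes>\<^bsub>S\<^esub> a)"
      unfolding c(2) by (simp add: finsum_def restrict_scalars_def finprod_def)
    then show ?thesis
      using pow_image_submodule[of A c v e] A c(1) v by auto
  qed
  then have "v \<in> inseparability_ideal e" using v(1) by (simp add: inseparability_ideal_def)
  then show thesis using that v(1) by blast
qed

lemma imp_purely_inseparable_locus:
  assumes "\<not> inseparability_ideal e \<subseteq> P"
  shows "P \<in> purely_inseparable_locus p R S \<phi>"
proof -
  obtain u where u: "u \<in> inseparability_ideal e" "u \<notin> P" using assms by blast
  \<comment> \<open>By injectivity, an element of R whose image comes from outside P is itself
    outside P.\<close>
  have disjoint: "\<forall>r\<in>carrier R. \<phi> r \<in> \<phi> ` (carrier R - P) \<longrightarrow> r \<notin> P"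
    using inj by (auto dest: inj_onD)
  have "localized_map R S \<phi> P = fraction_map S (\<phi> ` (carrier R - P)) \<phi>"
    by (simp add: localized_map_def fraction_map_def fun_eq_iff)
  with localized_purely_inseparable[OF u base_change_mult_closed order_refl disjoint]
  have "purely_inseparable p (localization_at R P) (base_change_at R S \<phi> P) (localized_map R S \<phi> P)"
    unfolding purely_inseparable_def ring_extension_def base_change_at_def
    by (simp only: simp_thms) (intro ballI exI[of _ e])
  with P show ?thesis unfolding purely_inseparable_locus_def by blast
qed

text \<open>Taking E to be the complement of Q yields R_P -> S_Q directly; both conditions relating
  E to P express that Q contracts to P.\<close>

lemma Fte_le:
  assumes "\<not> inseparability_ideal e \<subseteq> P" "Q \<in> Spec S" "contraction R \<phi> Q = P"
    and "F_pure p (localization_at S Q)" "ideal I (localization_at R P)"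
  shows "Fte p (localization_at R P) I \<le> enat e"
proof -
  interpret Q: primeideal Q S using assms(2) by (simp add: Spec_def)
  obtain u where u: "u \<in> inseparability_ideal e" "u \<notin> P" using assms(1) by blast
  have E: "mult_closed S (carrier S - Q)" "\<phi> ` (carrier R - P) \<subseteq> carrier S - Q"
    using Q.mult_closed_complement unfolding assms(3)[symmetric] contraction_def by auto
  have disjoint: "\<forall>r\<in>carrier R. \<phi> r \<in> carrier S - Q \<longrightarrow> r \<notin> P"
    unfolding assms(3)[symmetric] contraction_def by blast
  note L = localized_purely_inseparable[OF u E disjoint]
  have "cring (localization_at R P)" "cring (localization S (carrier S - Q))"
    unfolding localization_at_def
    using mult_closed.localization_cring P.mult_closed_complement E(1) by blast+
  then show ?thesis
    using Fte_le_of_purely_inseparable[OF _ _ L assms(4)[unfolded localization_at_def] assms(5)] by blast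
qed

end

section \<open>Openness of the locus and the uniform bound\<close>

lemma openin_purely_inseparable_locus:
  assumes "finite_ring_map R S \<phi>" "\<And>e. inseparability_ideal e \<subseteq> inseparability_ideal e0"
  shows "purely_inseparable_locus p R S \<phi> = {P \<in> Spec R. \<not> inseparability_ideal e0 \<subseteq> P}"
    and "openin (zariski_topology R) (purely_inseparable_locus p R S \<phi>)"
proof -
  show *: "purely_inseparable_locus p R S \<phi> = {P \<in> Spec R. \<not> inseparability_ideal e0 \<subseteq> P}"
  proof (intro equalityI subsetI CollectI conjI)
    fix P assume P: "P \<in> purely_inseparable_locus p R S \<phi>"
    then show "P \<in> Spec R" by (simp add: purely_inseparable_locus_def)
    then obtain e where "\<not> inseparability_ideal e \<subseteq> P"
      using purely_inseparable_locus_imp[OF _ assms(1) P] by blast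
    then show "\<not> inseparability_ideal e0 \<subseteq> P" using order_trans[OF assms(2)[of e]] by auto
  next
    fix P assume "P \<in> {P \<in> Spec R. \<not> inseparability_ideal e0 \<subseteq> P}"
    then show "P \<in> purely_inseparable_locus p R S \<phi>"
      by (intro imp_purely_inseparable_locus[of _ e0]) auto
  qed
  have "inseparability_ideal e0 \<subseteq> carrier R" by (auto simp: inseparability_ideal_def)
  then show "openin (zariski_topology R) (purely_inseparable_locus p R S \<phi>)"
    unfolding openin_zariski_topology[OF R.is_cring] * by blast
qed

end

theorem theorem1p4:
  fixes R :: "('a, 'r) ring_scheme" and S :: "('b, 's) ring_scheme"
    and \<phi> :: "'a \<Rightarrow> 'b" and p :: nat
  assumes "normalization_semidom_class.prime p"
    and "cring R" and "noetherian_ring R" and "ring_char R = p" and "F_finite p R"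
    and "cring S" and "noetherian_ring S" and "ring_char S = p" and "F_finite p S"
    and "ring_extension R S \<phi>" and "finite_ring_map R S \<phi>"
  shows "(\<exists>e0::nat. \<forall>P \<in> purely_inseparable_locus p R S \<phi>. \<forall>Q \<in> Spec S.
            contraction R \<phi> Q = P \<longrightarrow> F_pure p (localization_at S Q) \<longrightarrow>
            (\<forall>I. ideal I (localization_at R P) \<longrightarrow> Fte p (localization_at R P) I \<le> enat e0))
       \<and> (openin (zariski_topology R) (contraction R \<phi> ` F_pure_locus p S) \<longrightarrow>
           (\<exists>U. openin (zariski_topology R) U \<and>
                U = purely_inseparable_locus p R S \<phi> \<inter> contraction R \<phi> ` F_pure_locus p S \<and>
                (\<exists>e1::nat. \<forall>P\<in>U. \<forall>I. ideal I (localization_at R P) \<longrightarrow>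
                   Fte p (localization_at R P) I \<le> enat e1)))"
proof -
  have "\<phi> \<in> ring_hom R S" "inj_on \<phi> (carrier R)" "frobenius p S \<in> ring_hom S S" "0 < p"
    using prime_gt_0_nat[OF \<open>normalization_semidom_class.prime p\<close>] \<open>ring_extension R S \<phi>\<close> \<open>F_finite p S\<close>
    by (simp_all add: ring_extension_def F_finite_def finite_ring_map_def)
  then interpret frobenius_extension R S \<phi> p
    using \<open>cring R\<close> \<open>cring S\<close> by (intro frobenius_extension.intro frobenius_extension_axioms.intro)
  let ?X = "purely_inseparable_locus p R S \<phi>"
  obtain e0 where e0: "\<And>e. inseparability_ideal e \<subseteq> inseparability_ideal e0"
    using inseparability_ideal_stabilizes[OF \<open>noetherian_ring R\<close>] by blast
  note X = openin_purely_inseparable_locus[OF \<open>finite_ring_map R S \<phi>\<close> e0]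
  have bound: "Fte p (localization_at R P) I \<le> enat e0"
    if "P \<in> ?X" "Q \<in> Spec S" "contraction R \<phi> Q = P" "F_pure p (localization_at S Q)"
      "ideal I (localization_at R P)" for P Q I
    using that unfolding X(1) by (intro Fte_le) auto
  have "openin (zariski_topology R) (?X \<inter> contraction R \<phi> ` F_pure_locus p S)"
    if "openin (zariski_topology R) (contraction R \<phi> ` F_pure_locus p S)"
    using X(2) that by (rule openin_Int)
  \<comment> \<open>A point of the intersection is the contraction of some Q with F-pure local ring,
    so e0 also serves as the bound e1.\<close>
  moreover have "Fte p (localization_at R P) I \<le> enat e0"
    if "P \<in> ?X \<inter> contraction R \<phi> ` F_pure_locus p S" "ideal I (localization_at R P)" for P I
    using that bound by (auto simp: F_pure_locus_def)
  ultimately show ?thesis using bound by blast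
qed

end
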